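(* Let $n\ge 2$ and let $\mathbf A$ be a Boolean-like algebra of dimension $n$ of type $\tau$ whose minimal subalgebra $\mathbf E$ has finite cardinality $n$. Then $\mathbf A\cong\mathbf E[B_{\mathbf A}]\cong\mathcal C(B_{\mathbf A}^*,\mathbf E)$.
   Context: $\mathbf A$ is an algebra of dimension $n$ with respect to $\tau$-terms $q$ (arity $n+1$) and constant terms $\mathsf e_1,\dots,\mathsf e_n$ if $q(\mathsf e_i,b_1,\dots,b_n)=b_i$ for all $b_j$. $\theta(a,b)$ is the smallest congruence containing $(a,b)$; $c$ is $n$-central if $x\mapsto(x/\theta(c,\mathsf e_1),\dots,x/\theta(c,\mathsf e_n))$ is an isomorphism from $\mathbf A$ onto $\prod_i\mathbf A/\theta(c,\mathsf e_i)$; a Boolean-like algebra of dimension $n$ is one where every element is $n$-central. The minimal subalgebra of $\mathbf A$ is the subalgebra generated by the empty set. Let $p(x,y,z)=q(x,y,z,\mathsf e_3,\dots,\mathsf e_n)$ and $B_{\mathbf A}=\{x\in A:p(x,y,y)=y\ \forall y\in A\}$, a Boolean algebra with $x\wedge y=p(x,\mathsf e_1,y)$, $x\vee y=p(x,y,\mathsf e_2)$, $\neg x=p(x,\mathsf e_2,\mathsf e_1)$, $0=\mathsf e_1$, $1=\mathsf e_2$; it is regarded as the semiring $(B_{\mathbf A},\vee,\wedge,0,1)$. Semiring power: for a semiring $R$ and an algebra $\mathbf E$ of type $\tau$ with universe $E$, let $V$ be the free left $R$-semimodule on $E$ (finite-support formal sums $\sum_{\mathsf d\in E}v_{\mathsf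 d}\mathsf d$, basis element $\mathsf d$ identified with the vector with coordinate $1$ at $\mathsf d$); lift each $k$-ary $g\in\tau$ by $g^V(\mathbf v^1,\dots,\mathbf v^k)=\sum_{\mathsf d_1,\dots,\mathsf d_k}(v^1_{\mathsf d_1}\cdots v^k_{\mathsf d_k})g^{\mathbf E}(\mathsf d_1,\dots,\mathsf d_k)$; for finite nonempty $I=\{\mathsf c_1,\dots,\mathsf c_m\}\subseteq E$ let $q_I(\mathbf v,\mathbf w^1,\dots,\mathbf w^m)=\sum_iv_{\mathsf c_i}\mathbf w^i$; $V_{\mathbf E}$ is $V$ with the semimodule operations, all $g^V$, all $q_I$ and all elements of $E$ as constants; $\mathbf v$ is finitely central if for some such $I$ it is $m$-central in $V_{\mathbf E}$ with respect to $q_I$ and $\mathsf c_1,\dots,\mathsf c_m$; $\mathbf E[R]$ is the set of finitely central vectors with the restricted operations $g^V$, $g\in\tau$. For a Boolean algebra $B$, $B^*$ is its Stone space and $\mathcal C(B^*,\mathbf E)$ is the algebra of continuous maps $B^*\to E$ ($E$ discrete) with pointwise operations. *)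

theory Defs
  imports "HOL-Algebra.Ring" "HOL-Analysis.Abstract_Topology"
begin

section \<open>Universal algebra\<close>

record 'f signature =
  syms :: "'f set"
  ar :: "'f \<Rightarrow> nat"

record ('f, 'a) alg =
  univ :: "'a set"
  interp :: "'f \<Rightarrow> 'a list \<Rightarrow> 'a"

definition subuniverse :: "'f signature \<Rightarrow> ('f, 'a) alg \<Rightarrow> 'a set \<Rightarrow> bool" where
  "subuniverse \<Sigma> A S \<longleftrightarrow> S \<subseteq> univ A \<and>
     (\<forall>f\<in>syms \<Sigma>. \<forall>xs. length xs = ar \<Sigma> f \<and> set xs \<subseteq> S \<longrightarrow> interp A f xs \<in> S)"

definition is_alg :: "'f signature \<Rightarrow> ('f, 'a) alg \<Rightarrow> bool" where
  "is_alg \<Sigma> A \<longleftrightarrow> univ A \<noteq> {} \<and> subuniverse \<Sigma> A (univ A)"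

definition generated_subalg :: "'f signature \<Rightarrow> ('f, 'a) alg \<Rightarrow> 'a set \<Rightarrow> ('f, 'a) alg" where
  "generated_subalg \<Sigma> A X = A\<lparr>univ := \<Inter>{S. subuniverse \<Sigma> A S \<and> X \<subseteq> S}\<rparr>"

definition minimal_subalg :: "'f signature \<Rightarrow> ('f, 'a) alg \<Rightarrow> ('f, 'a) alg" where
  "minimal_subalg \<Sigma> A = generated_subalg \<Sigma> A {}"

definition is_iso ::
  "'f signature \<Rightarrow> ('f, 'a) alg \<Rightarrow> ('f, 'b) alg \<Rightarrow> ('a \<Rightarrow> 'b) \<Rightarrow> bool" where
  "is_iso \<Sigma> A B h \<longleftrightarrow> bij_betw h (univ A) (univ B) \<and>
     (\<forall>f\<in>syms \<Sigma>. \<forall>xs. length xs = ar \<Sigma> f \<and> set xs \<subseteq> univ A \<longrightarrow>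
        h (interp A f xs) = interp B f (map h xs))"

definition isomorphic :: "'f signature \<Rightarrow> ('f, 'a) alg \<Rightarrow> ('f, 'b) alg \<Rightarrow> bool" where
  "isomorphic \<Sigma> A B \<longleftrightarrow> (\<exists>h. is_iso \<Sigma> A B h)"

definition is_congruence :: "'f signature \<Rightarrow> ('f, 'a) alg \<Rightarrow> ('a \<times> 'a) set \<Rightarrow> bool" where
  "is_congruence \<Sigma> A r \<longleftrightarrow> equiv (univ A) r \<and>
     (\<forall>f\<in>syms \<Sigma>. \<forall>xs ys. length xs = ar \<Sigma> f \<and> list_all2 (\<lambda>x y. (x, y) \<in> r) xs ys \<longrightarrow>
        (interp A f xs, interp A f ys) \<in> r)"

definition principal_cong ::
  "'f signature \<Rightarrow> ('f, 'a) alg \<Rightarrow> 'a \<Rightarrow> 'a \<Rightarrow> ('a \<times> 'a) set" where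
  "principal_cong \<Sigma> A a b = \<Inter>{r. is_congruence \<Sigma> A r \<and> (a, b) \<in> r}"

text \<open>For a congruence \<open>r\<close>, the value below is the single class of \<open>interp A f xs\<close>,
  for any choice \<open>xs\<close> of representatives of \<open>Xs\<close>.\<close>

definition quotient_alg :: "('f, 'a) alg \<Rightarrow> ('a \<times> 'a) set \<Rightarrow> ('f, 'a set) alg" where
  "quotient_alg A r = \<lparr>univ = univ A // r,
     interp = (\<lambda>f Xs. r `` {interp A f xs | xs. list_all2 (\<in>) xs Xs})\<rparr>"

definition product_alg :: "'i set \<Rightarrow> ('i \<Rightarrow> ('f, 'a) alg) \<Rightarrow> ('f, 'i \<Rightarrow> 'a) alg" where
  "product_alg I B = \<lparr>univ = (\<Pi>\<^sub>E i\<in>I. univ (B i)),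
     interp = (\<lambda>f xs. \<lambda>i\<in>I. interp (B i) f (map (\<lambda>x. x i) xs))\<rparr>"

datatype 'f trm = Var nat | App 'f "'f trm list"

fun trm_in :: "'f signature \<Rightarrow> nat \<Rightarrow> 'f trm \<Rightarrow> bool" where
  "trm_in \<Sigma> k (Var i) \<longleftrightarrow> i < k"
| "trm_in \<Sigma> k (App f ts) \<longleftrightarrow>
     f \<in> syms \<Sigma> \<and> length ts = ar \<Sigma> f \<and> (\<forall>t\<in>set ts. trm_in \<Sigma> k t)"

fun trm_op :: "('f, 'a) alg \<Rightarrow> 'f trm \<Rightarrow> 'a list \<Rightarrow> 'a" where
  "trm_op A (Var i) xs = xs ! i"
| "trm_op A (App f ts) xs = interp A f (map (\<lambda>t. trm_op A t xs) ts)"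


section \<open>Algebras of dimension n and central elements\<close>

text \<open>The constants \<open>e\<^sub>1, \<dots>, e\<^sub>n\<close> are given as a list \<open>es\<close> of closed terms, so
  \<open>e\<^sub>i\<close> is \<open>es ! (i - 1)\<close>.\<close>

definition dim_alg ::
  "'f signature \<Rightarrow> ('f, 'a) alg \<Rightarrow> nat \<Rightarrow> 'f trm \<Rightarrow> 'f trm list \<Rightarrow> bool" where
  "dim_alg \<Sigma> A n q es \<longleftrightarrow> is_alg \<Sigma> A \<and>
     trm_in \<Sigma> (n + 1) q \<and> length es = n \<and> (\<forall>e\<in>set es. trm_in \<Sigma> 0 e) \<and>
     (\<forall>i<n. \<forall>bs. length bs = n \<and> set bs \<subseteq> univ A \<longrightarrow>
        trm_op A q (trm_op A (es ! i) [] # bs) = bs ! i)"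

definition central ::
  "'f signature \<Rightarrow> ('f, 'a) alg \<Rightarrow> nat \<Rightarrow> 'f trm \<Rightarrow> 'f trm list \<Rightarrow> 'a \<Rightarrow> bool" where
  "central \<Sigma> A n q es c \<longleftrightarrow> dim_alg \<Sigma> A n q es \<and> c \<in> univ A \<and>
     (let \<theta> = (\<lambda>i. principal_cong \<Sigma> A c (trm_op A (es ! i) []))
      in is_iso \<Sigma> A (product_alg {..<n} (\<lambda>i. quotient_alg A (\<theta> i)))
           (\<lambda>x. \<lambda>i\<in>{..<n}. \<theta> i `` {x}))"

definition boolean_like ::
  "'f signature \<Rightarrow> ('f, 'a) alg \<Rightarrow> nat \<Rightarrow> 'f trm \<Rightarrow> 'f trm list \<Rightarrow> bool" where
  "boolean_like \<Sigma> A n q es \<longleftrightarrow> dim_alg \<Sigma> A n q es \<and> (\<forall>c\<in>univ A. central \<Sigma> A n q es c)"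


section \<open>The Boolean algebra of an algebra of dimension n\<close>

record 'a bool_alg = "'a partial_object" +
  meet :: "'a \<Rightarrow> 'a \<Rightarrow> 'a"
  join :: "'a \<Rightarrow> 'a \<Rightarrow> 'a"
  compl :: "'a \<Rightarrow> 'a"
  bottom :: 'a
  unit :: 'a

definition p_op :: "('f, 'a) alg \<Rightarrow> 'f trm \<Rightarrow> 'f trm list \<Rightarrow> 'a \<Rightarrow> 'a \<Rightarrow> 'a \<Rightarrow> 'a" where
  "p_op A q es x y z = trm_op A q ([x, y, z] @ map (\<lambda>e. trm_op A e []) (drop 2 es))"

definition B_alg :: "('f, 'a) alg \<Rightarrow> 'f trm \<Rightarrow> 'f trm list \<Rightarrow> 'a bool_alg" where
  "B_alg A q es =
     (let p = p_op A q es; e1 = trm_op A (es ! 0) []; e2 = trm_op A (es ! 1) []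
      in \<lparr>carrier = {x \<in> univ A. \<forall>y\<in>univ A. p x y y = y},
          meet = (\<lambda>x y. p x e1 y),
          join = (\<lambda>x y. p x y e2),
          compl = (\<lambda>x. p x e2 e1),
          bottom = e1,
          unit = e2\<rparr>)"

definition semiring_of :: "'a bool_alg \<Rightarrow> 'a ring" where
  "semiring_of B = \<lparr>carrier = carrier B, mult = meet B, one = unit B,
     zero = bottom B, add = join B\<rparr>"


section \<open>Semiring powers\<close>

text \<open>A formal sum over \<open>E\<close> is its coefficient function, extended by zero outside \<open>E\<close>.\<close>

definition vectors :: "'r ring \<Rightarrow> 'e set \<Rightarrow> ('e \<Rightarrow> 'r) set" where
  "vectors R E = {v. (\<forall>d\<in>E. v d \<in> carrier R) \<and> (\<forall>d. d \<notin> E \<longrightarrow> v d = \<zero>\<^bsub>R\<^esub>) \<and>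
     finite {d\<in>E. v d \<noteq> \<zero>\<^bsub>R\<^esub>}}"

definition basis_vec :: "'r ring \<Rightarrow> 'e \<Rightarrow> 'e \<Rightarrow> 'r" where
  "basis_vec R e = (\<lambda>d. if d = e then \<one>\<^bsub>R\<^esub> else \<zero>\<^bsub>R\<^esub>)"

text \<open>The sum runs over the tuples \<open>ds\<close> with each \<open>d\<^sub>i\<close> in the support of \<open>v\<^sup>i\<close>, because
  \<^const>\<open>finsum\<close> over an infinite index set is zero by convention; all other tuples
  contribute zero.\<close>

definition lift_op ::
  "'r ring \<Rightarrow> ('f, 'e) alg \<Rightarrow> 'f \<Rightarrow> ('e \<Rightarrow> 'r) list \<Rightarrow> 'e \<Rightarrow> 'r" where
  "lift_op R E g vs = (\<lambda>d.
     \<Oplus>\<^bsub>R\<^esub>ds\<in>{ds. list_all2 (\<lambda>v e. e \<in> univ E \<and> v e \<noteq> \<zero>\<^bsub>R\<^esub>) vs ds}.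
       foldr (\<lambda>x y. x \<otimes>\<^bsub>R\<^esub> y) (map2 (\<lambda>v e. v e) vs ds) \<one>\<^bsub>R\<^esub> \<otimes>\<^bsub>R\<^esub> basis_vec R (interp E g ds) d)"

text \<open>A finite nonempty \<open>I = {c\<^sub>1, \<dots>, c\<^sub>m}\<close> is presented by an enumeration without
  repetitions, since the order of the arguments of \<open>q\<^sub>I\<close> depends on it.\<close>

datatype ('f, 'r, 'e) vsym = Base 'f | Plus | Zero | Scale 'r | Q "'e list" | Const 'e

definition enumerations :: "'e set \<Rightarrow> 'e list set" where
  "enumerations E = {cs. cs \<noteq> [] \<and> distinct cs \<and> set cs \<subseteq> E}"

fun vsym_ar :: "'f signature \<Rightarrow> ('f, 'r, 'e) vsym \<Rightarrow> nat" where
  "vsym_ar \<Sigma> (Base g) = ar \<Sigma> g"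
| "vsym_ar \<Sigma> Plus = 2"
| "vsym_ar \<Sigma> Zero = 0"
| "vsym_ar \<Sigma> (Scale r) = 1"
| "vsym_ar \<Sigma> (Q cs) = length cs + 1"
| "vsym_ar \<Sigma> (Const e) = 0"

definition vec_sig ::
  "'f signature \<Rightarrow> 'r ring \<Rightarrow> ('f, 'e) alg \<Rightarrow> ('f, 'r, 'e) vsym signature" where
  "vec_sig \<Sigma> R E = \<lparr>syms = Base ` syms \<Sigma> \<union> {Plus, Zero} \<union> Scale ` carrier R
       \<union> Q ` enumerations (univ E) \<union> Const ` univ E,
     ar = vsym_ar \<Sigma>\<rparr>"

fun vec_interp ::
  "'r ring \<Rightarrow> ('f, 'e) alg \<Rightarrow> ('f, 'r, 'e) vsym \<Rightarrow> ('e \<Rightarrow> 'r) list \<Rightarrow> 'e \<Rightarrow> 'r" where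
  "vec_interp R E (Base g) vs = lift_op R E g vs"
| "vec_interp R E Plus vs = (\<lambda>d. (vs ! 0) d \<oplus>\<^bsub>R\<^esub> (vs ! 1) d)"
| "vec_interp R E Zero vs = (\<lambda>d. \<zero>\<^bsub>R\<^esub>)"
| "vec_interp R E (Scale r) vs = (\<lambda>d. r \<otimes>\<^bsub>R\<^esub> (vs ! 0) d)"
| "vec_interp R E (Q cs) vs =
     (\<lambda>d. \<Oplus>\<^bsub>R\<^esub>i\<in>{..<length cs}. (vs ! 0) (cs ! i) \<otimes>\<^bsub>R\<^esub> (vs ! (i + 1)) d)"
| "vec_interp R E (Const e) vs = basis_vec R e"

definition vec_alg ::
  "'r ring \<Rightarrow> ('f, 'e) alg \<Rightarrow> (('f, 'r, 'e) vsym, 'e \<Rightarrow> 'r) alg" where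
  "vec_alg R E = \<lparr>univ = vectors R (univ E), interp = vec_interp R E\<rparr>"

definition finitely_central ::
  "'f signature \<Rightarrow> 'r ring \<Rightarrow> ('f, 'e) alg \<Rightarrow> ('e \<Rightarrow> 'r) \<Rightarrow> bool" where
  "finitely_central \<Sigma> R E v \<longleftrightarrow> (\<exists>cs\<in>enumerations (univ E).
     central (vec_sig \<Sigma> R E) (vec_alg R E) (length cs)
       (App (Q cs) (map Var [0..<length cs + 1])) (map (\<lambda>c. App (Const c) []) cs) v)"

definition semiring_power ::
  "'f signature \<Rightarrow> ('f, 'e) alg \<Rightarrow> 'r ring \<Rightarrow> ('f, 'e \<Rightarrow> 'r) alg" where
  "semiring_power \<Sigma> E R = \<lparr>univ = {v. finitely_central \<Sigma> R E v}, interp = lift_op R E\<rparr>"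


section \<open>Stone space and algebras of continuous maps\<close>

definition ultrafilter :: "'a bool_alg \<Rightarrow> 'a set \<Rightarrow> bool" where
  "ultrafilter B F \<longleftrightarrow> F \<subseteq> carrier B \<and> unit B \<in> F \<and> bottom B \<notin> F \<and>
     (\<forall>a\<in>F. \<forall>b\<in>F. meet B a b \<in> F) \<and>
     (\<forall>a\<in>F. \<forall>b\<in>carrier B. meet B a b = a \<longrightarrow> b \<in> F) \<and>
     (\<forall>a\<in>carrier B. a \<in> F \<or> compl B a \<in> F)"

definition stone_space :: "'a bool_alg \<Rightarrow> 'a set topology" where
  "stone_space B = topology_generated_by {{F. ultrafilter B F \<and> a \<in> F} | a. a \<in> carrier B}"

definition continuous_alg :: "'x topology \<Rightarrow> ('f, 'e) alg \<Rightarrow> ('f, 'x \<Rightarrow> 'e) alg" where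
  "continuous_alg X E =
     \<lparr>univ = {h \<in> extensional (topspace X). continuous_map X (discrete_topology (univ E)) h},
      interp = (\<lambda>f hs. \<lambda>x\<in>topspace X. interp E f (map (\<lambda>h. h x) hs))\<rparr>"

end

theory Submission
  imports Defs
begin

text \<open>Let \<open>X\<close> be the set of homomorphisms \<open>A \<rightarrow> E\<close> that fix \<open>E\<close>. Here \<open>E\<close> consists of the \<open>n\<close>
  constants. If \<open>\<phi>\<close> is a congruence maximal without a given pair, then every central \<open>c\<close> splits
  \<open>\<phi>\<close> as an intersection of congruences containing \<open>(c, e\<^sub>i)\<close>, so by maximality \<open>c\<close> is congruent to
  some \<open>e\<^sub>i\<close>, and \<open>A / \<phi>\<close> is \<open>E\<close>. Hence \<open>X\<close> separates points, and it is compact.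
  Everything else can be checked pointwise on \<open>X\<close>: the elements of \<open>B\<^sub>A\<close> are those taking only
  the values \<open>e\<^sub>1\<close> and \<open>e\<^sub>2\<close>, the finitely central vectors are the partitions of unity
  \<open>d \<mapsto> [c = d]\<close> with \<open>c \<in> A\<close>, the ultrafilters of \<open>B\<^sub>A\<close> are the sets
  \<open>{b. h b = e\<^sub>2}\<close> with \<open>h \<in> X\<close>, and continuous maps on \<open>X\<close> come from \<open>A\<close> by compactness.\<close>

section \<open>Terms, congruences and central elements\<close>

text \<open>Both representations are reached from \<open>A\<close>, so the isomorphism between them
  is \<open>k\<close> after the inverse of \<open>h\<close>. Closure of \<open>A\<close> under its
  operations makes that inverse compatible with them.\<close>

lemma isomorphic_span:
  assumes A: "is_alg \<Sigma> A" and h: "is_iso \<Sigma> A B h" and k: "is_iso \<Sigma> A C k"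
  shows "isomorphic \<Sigma> B C"
proof -
  let ?g = "inv_into (univ A) h"
  have hg: "h (?g y) = y" if "y \<in> univ B" for y
    using h that by (auto simp: is_iso_def bij_betw_inv_into_right)
  have bij: "bij_betw ?g (univ B) (univ A)"
    using h by (auto simp: is_iso_def bij_betw_inv_into)
  have "(k \<circ> ?g) (interp B f ys) = interp C f (map (k \<circ> ?g) ys)"
    if f: "f \<in> syms \<Sigma>" "length ys = ar \<Sigma> f" "set ys \<subseteq> univ B" for f ys
  proof -
    let ?xs = "map ?g ys"
    have xs: "length ?xs = ar \<Sigma> f" "set ?xs \<subseteq> univ A"
      using f bij by (auto simp: bij_betw_def)
    have "map h ?xs = ys" using f hg by (auto intro!: map_idI)
    then have "h (interp A f ?xs) = interp B f ys" using h f xs by (auto simp: is_iso_def)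
    moreover have "interp A f ?xs \<in> univ A"
      using A f xs by (simp add: is_alg_def subuniverse_def del: set_map)
    ultimately have "?g (interp B f ys) = interp A f ?xs"
      using h by (auto simp: is_iso_def bij_betw_def inv_into_f_eq)
    then show ?thesis using k f xs by (auto simp: is_iso_def)
  qed
  moreover have "bij_betw (k \<circ> ?g) (univ B) (univ C)"
    using bij k by (auto simp: is_iso_def intro: bij_betw_trans)
  ultimately show ?thesis unfolding isomorphic_def is_iso_def by blast
qed

lemma trm_op_closed:
  assumes "subuniverse \<Sigma> A S" "trm_in \<Sigma> (length xs) t" "set xs \<subseteq> S"
  shows "trm_op A t xs \<in> S"
  using assms(2)
proof (induction t)
  case (Var i)
  then show ?case using assms(3) by (auto simp: subset_iff)
next
  case (App f ts)
  then show ?case using assms(1) by (auto simp: subuniverse_def image_subset_iff)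
qed

lemma trm_op_congruence:
  assumes "is_congruence \<Sigma> A r" "trm_in \<Sigma> (length xs) t" "list_all2 (\<lambda>x y. (x, y) \<in> r) xs ys"
  shows "(trm_op A t xs, trm_op A t ys) \<in> r"
  using assms(2)
proof (induction t)
  case (Var i)
  then show ?case using assms(3) by (auto simp: list_all2_conv_all_nth)
next
  case (App f ts)
  then have "list_all2 (\<lambda>x y. (x, y) \<in> r) (map (\<lambda>t. trm_op A t xs) ts) (map (\<lambda>t. trm_op A t ys) ts)"
    by (auto simp: list_all2_conv_all_nth)
  then show ?case using App.prems assms(1) by (auto simp: is_congruence_def)
qed

lemma trm_op_hom:
  assumes "subuniverse \<Sigma> A (univ A)"
    and "\<And>f xs. f \<in> syms \<Sigma> \<Longrightarrow> length xs = ar \<Sigma> f \<Longrightarrow> set xs \<subseteq> univ A \<Longrightarrow>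
      h (interp A f xs) = interp B f (map h xs)"
    and "trm_in \<Sigma> (length xs) t" "set xs \<subseteq> univ A"
  shows "h (trm_op A t xs) = trm_op B t (map h xs)"
  using assms(3)
proof (induction t)
  case (Var i)
  then show ?case by simp
next
  case (App f ts)
  have "set (map (\<lambda>t. trm_op A t xs) ts) \<subseteq> univ A"
    using App.prems trm_op_closed[OF assms(1) _ assms(4)] by auto
  then have "h (trm_op A (App f ts) xs) = interp B f (map h (map (\<lambda>t. trm_op A t xs) ts))"
    using App.prems assms(2) by simp
  also have "map h (map (\<lambda>t. trm_op A t xs) ts) = map (\<lambda>t. trm_op B t (map h xs)) ts"
    using App by auto
  finally show ?case by simp
qed

section \<open>Congruences and quotients\<close>

lemma congruence_dom:
  "is_congruence \<Sigma> A r \<Longrightarrow> (x, y) \<in> r \<Longrightarrow> x \<in> univ A \<and> y \<in> univ A"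
  by (auto simp: is_congruence_def equiv_def refl_on_def)

lemma congruence_refl: "is_congruence \<Sigma> A r \<Longrightarrow> x \<in> univ A \<Longrightarrow> (x, x) \<in> r"
  by (auto simp: is_congruence_def equiv_def refl_on_def)

lemma congruence_sym: "is_congruence \<Sigma> A r \<Longrightarrow> (x, y) \<in> r \<Longrightarrow> (y, x) \<in> r"
  by (auto simp: is_congruence_def equiv_def dest: symD)

lemma congruence_trans:
  "is_congruence \<Sigma> A r \<Longrightarrow> (x, y) \<in> r \<Longrightarrow> (y, z) \<in> r \<Longrightarrow> (x, z) \<in> r"
  unfolding is_congruence_def equiv_def by (meson transD)

lemma congruence_op:
  "is_congruence \<Sigma> A r \<Longrightarrow> f \<in> syms \<Sigma> \<Longrightarrow> length xs = ar \<Sigma> f \<Longrightarrow>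
    list_all2 (\<lambda>x y. (x, y) \<in> r) xs ys \<Longrightarrow> (interp A f xs, interp A f ys) \<in> r"
  by (auto simp: is_congruence_def)

text \<open>Related elements lie in the universe, so compatibility may be checked under that extra
  assumption.\<close>

lemma is_congruenceI:
  assumes "r \<subseteq> univ A \<times> univ A" "\<And>x. x \<in> univ A \<Longrightarrow> (x, x) \<in> r"
    "\<And>x y. (x, y) \<in> r \<Longrightarrow> (y, x) \<in> r"
    "\<And>x y z. (x, y) \<in> r \<Longrightarrow> (y, z) \<in> r \<Longrightarrow> (x, z) \<in> r"
    "\<And>f xs ys. f \<in> syms \<Sigma> \<Longrightarrow> length xs = ar \<Sigma> f \<Longrightarrow> list_all2 (\<lambda>x y. (x, y) \<in> r) xs ys
      \<Longrightarrow> set xs \<subseteq> univ A \<Longrightarrow> set ys \<subseteq> univ A \<Longrightarrow> (interp A f xs, interp A f ys) \<in> r"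
  shows "is_congruence \<Sigma> A r"
proof -
  have "set xs \<subseteq> univ A" "set ys \<subseteq> univ A" if "list_all2 (\<lambda>x y. (x, y) \<in> r) xs ys" for xs ys
    using that assms(1) by (fastforce simp: list_all2_conv_all_nth in_set_conv_nth)+
  moreover have "equiv (univ A) r"
    unfolding equiv_def refl_on_def sym_def trans_def using assms(1-4) by blast
  ultimately show ?thesis using assms(5) by (auto simp: is_congruence_def)
qed

lemma is_congruence_Id_on:
  assumes "is_alg \<Sigma> A"
  shows "is_congruence \<Sigma> A (Id_on (univ A))"
proof (rule is_congruenceI)
  fix f xs ys
  assume *: "f \<in> syms \<Sigma>" "length xs = ar \<Sigma> f" "set xs \<subseteq> univ A"
    "list_all2 (\<lambda>x y. (x, y) \<in> Id_on (univ A)) xs ys"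
  then have "xs = ys" by (auto simp: list_all2_conv_all_nth Id_on_iff intro: nth_equalityI)
  then show "(interp A f xs, interp A f ys) \<in> Id_on (univ A)"
    using * assms by (auto simp: is_alg_def subuniverse_def)
qed auto

lemma principal_cong_congruence:
  assumes "is_alg \<Sigma> A" "a \<in> univ A" "b \<in> univ A"
  shows "is_congruence \<Sigma> A (principal_cong \<Sigma> A a b)"
proof -
  \<comment> \<open>The full relation is among the intersected congruences, which keeps the
    intersection inside the universe.\<close>
  have total: "is_congruence \<Sigma> A (univ A \<times> univ A)"
    using assms(1)
    by (intro is_congruenceI) (auto simp: is_alg_def subuniverse_def dest: list_all2_lengthD)
  show ?thesis
  proof (rule is_congruenceI)
    show "principal_cong \<Sigma> A a b \<subseteq> univ A \<times> univ A"
      using total assms by (auto simp: principal_cong_def)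
  next
    fix f xs ys
    assume "f \<in> syms \<Sigma>" "length xs = ar \<Sigma> f"
      "list_all2 (\<lambda>x y. (x, y) \<in> principal_cong \<Sigma> A a b) xs ys"
    moreover have "list_all2 (\<lambda>x y. (x, y) \<in> r) xs ys"
      if "is_congruence \<Sigma> A r \<and> (a, b) \<in> r" for r
      using calculation(3) that by (auto simp: principal_cong_def elim: list_all2_mono)
    ultimately show "(interp A f xs, interp A f ys) \<in> principal_cong \<Sigma> A a b"
      by (auto simp: principal_cong_def intro: congruence_op)
  qed (auto simp: principal_cong_def intro: congruence_refl congruence_sym congruence_trans)
qed

lemma principal_cong_pair: "(a, b) \<in> principal_cong \<Sigma> A a b"
  by (auto simp: principal_cong_def)

lemma principal_cong_least:
  "is_congruence \<Sigma> A r \<Longrightarrow> (a, b) \<in> r \<Longrightarrow> principal_cong \<Sigma> A a b \<subseteq> r"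
  by (auto simp: principal_cong_def)

lemma congruence_class_eq_iff:
  "is_congruence \<Sigma> A r \<Longrightarrow> x \<in> univ A \<Longrightarrow> y \<in> univ A \<Longrightarrow> r `` {x} = r `` {y} \<longleftrightarrow> (x, y) \<in> r"
  unfolding is_congruence_def by (meson eq_equiv_class_iff)

text \<open>The quotient operation collects the values at all lists of representatives; by
  compatibility these values lie in one class, and their image under \<open>r\<close> is that
  class.\<close>

lemma quotient_alg_class:
  assumes "is_congruence \<Sigma> A r" "f \<in> syms \<Sigma>" "length xs = ar \<Sigma> f" "set xs \<subseteq> univ A"
  shows "interp (quotient_alg A r) f (map (\<lambda>x. r `` {x}) xs) = r `` {interp A f xs}"
proof -
  have "list_all2 (\<in>) xs (map (\<lambda>x. r `` {x}) xs)"
    using assms by (auto simp: list_all2_conv_all_nth intro!: congruence_refl)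
  moreover have "(interp A f xs, interp A f ys) \<in> r" if "list_all2 (\<in>) ys (map (\<lambda>x. r `` {x}) xs)" for ys
    using that assms by (intro congruence_op) (auto simp: list_all2_conv_all_nth)
  ultimately show ?thesis
    unfolding quotient_alg_def using assms(1)
    by (auto intro: congruence_sym congruence_trans)
qed

section \<open>The decomposition term and central elements\<close>

lemma dim_alg_const_closed:
  assumes "dim_alg \<Sigma> A n q es" "i < n"
  shows "trm_op A (es ! i) [] \<in> univ A"
  using assms by (auto simp: dim_alg_def is_alg_def intro!: trm_op_closed)

lemma dim_alg_q_closed:
  assumes "dim_alg \<Sigma> A n q es" "c \<in> univ A" "length ws = n" "set ws \<subseteq> univ A"
  shows "trm_op A q (c # ws) \<in> univ A"
  using assms by (auto simp: dim_alg_def is_alg_def intro!: trm_op_closed)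

lemma dim_alg_q_congruence:
  assumes "dim_alg \<Sigma> A n q es" "length ws = n" "is_congruence \<Sigma> A r" "(c, c') \<in> r"
    "list_all2 (\<lambda>x y. (x, y) \<in> r) ws ws'"
  shows "(trm_op A q (c # ws), trm_op A q (c' # ws')) \<in> r"
  using assms by (auto simp: dim_alg_def intro!: trm_op_congruence)

text \<open>Modulo \<open>r\<close> the element \<open>c\<close> is a constant, at which
  \<open>q\<close> is a projection.\<close>

lemma dim_alg_q_proj_congruence:
  assumes "dim_alg \<Sigma> A n q es" "length ws = n" "set ws \<subseteq> univ A" "i < n"
    "is_congruence \<Sigma> A r" "(c, trm_op A (es ! i) []) \<in> r"
  shows "(trm_op A q (c # ws), ws ! i) \<in> r"
proof -
  have "(trm_op A q (c # ws), trm_op A q (trm_op A (es ! i) [] # ws)) \<in> r"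
    using assms congruence_refl[OF assms(5)]
    by (intro dim_alg_q_congruence[OF assms(1,2,5)]) (auto simp: list_all2_conv_all_nth subset_iff)
  then show ?thesis using assms by (auto simp: dim_alg_def)
qed

text \<open>The value of \<open>q\<close> solves the congruences because modulo the i-th one
  \<open>c\<close> is the i-th constant. Injectivity of the map into the product makes the solution
  unique.\<close>

lemma central_eq_iff:
  assumes c: "central \<Sigma> A n q es c" and "length ws = n" "set ws \<subseteq> univ A" "y \<in> univ A"
  shows "y = trm_op A q (c # ws) \<longleftrightarrow>
    (\<forall>i<n. (y, ws ! i) \<in> principal_cong \<Sigma> A c (trm_op A (es ! i) []))"
proof -
  let ?\<theta> = "\<lambda>i. principal_cong \<Sigma> A c (trm_op A (es ! i) [])"
  have d: "dim_alg \<Sigma> A n q es" and cA: "c \<in> univ A"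
    and inj: "inj_on (\<lambda>x. \<lambda>i\<in>{..<n}. ?\<theta> i `` {x}) (univ A)"
    using c by (auto simp: central_def is_iso_def bij_betw_def Let_def)
  have \<theta>: "is_congruence \<Sigma> A (?\<theta> i)" if "i < n" for i
    using that d cA dim_alg_const_closed[OF d] by (intro principal_cong_congruence) (auto simp: dim_alg_def)
  let ?x = "trm_op A q (c # ws)"
  have xA: "?x \<in> univ A" using dim_alg_q_closed[OF d cA] assms by auto
  have x: "(?x, ws ! i) \<in> ?\<theta> i" if "i < n" for i
    using dim_alg_q_proj_congruence[OF d assms(2,3) that \<theta>[OF that] principal_cong_pair] .
  have "y = ?x" if "\<forall>i<n. (y, ws ! i) \<in> ?\<theta> i"
  proof -
    have "(y, ?x) \<in> ?\<theta> i" if "i < n" for i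
      using x[OF that] \<open>\<forall>i<n. _\<close> that \<theta>[OF that] by (blast intro: congruence_sym congruence_trans)
    then have "(\<lambda>i\<in>{..<n}. ?\<theta> i `` {y}) = (\<lambda>i\<in>{..<n}. ?\<theta> i `` {?x})"
      using \<theta> xA assms(4) by (intro restrict_ext) (simp add: congruence_class_eq_iff[OF \<theta>])
    then show ?thesis using inj xA assms(4) by (auto dest: inj_onD)
  qed
  then show ?thesis using x by blast
qed

text \<open>A criterion with freely chosen congruences: the principal ones are contained in them, so
  they separate points as well. Surjectivity comes from \<open>q\<close>, which glues any family of
  representatives.\<close>

lemma centralI:
  assumes d: "dim_alg \<Sigma> A n q es" and c: "c \<in> univ A"
    and \<phi>: "\<And>i. i < n \<Longrightarrow> is_congruence \<Sigma> A (\<phi> i)"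
    "\<And>i. i < n \<Longrightarrow> (c, trm_op A (es ! i) []) \<in> \<phi> i"
    and sep: "\<And>x y. x \<in> univ A \<Longrightarrow> y \<in> univ A \<Longrightarrow> (\<forall>i<n. (x, y) \<in> \<phi> i) \<Longrightarrow> x = y"
  shows "central \<Sigma> A n q es c"
proof -
  define \<theta> where "\<theta> i = principal_cong \<Sigma> A c (trm_op A (es ! i) [])" for i
  have \<theta>: "is_congruence \<Sigma> A (\<theta> i)" if "i < n" for i
    using that d c dim_alg_const_closed[OF d] unfolding \<theta>_def
    by (intro principal_cong_congruence) (auto simp: dim_alg_def)
  have \<theta>\<phi>: "\<theta> i \<subseteq> \<phi> i" if "i < n" for i
    unfolding \<theta>_def using \<phi> that by (intro principal_cong_least) auto
  let ?P = "product_alg {..<n} (\<lambda>i. quotient_alg A (\<theta> i))"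
  let ?h = "\<lambda>x. \<lambda>i\<in>{..<n}. \<theta> i `` {x}"
  have "bij_betw ?h (univ A) (univ ?P)"
    unfolding bij_betw_def
  proof
    show "inj_on ?h (univ A)"
    proof (rule inj_onI)
      fix x y assume xy: "x \<in> univ A" "y \<in> univ A" "?h x = ?h y"
      have "(x, y) \<in> \<theta> i" if "i < n" for i
        using fun_cong[OF xy(3), of i] that congruence_class_eq_iff[OF \<theta>[OF that] xy(1,2)] by simp
      then show "x = y" using sep xy \<theta>\<phi> by blast
    qed
    show "?h ` univ A = univ ?P"
    proof
      show "?h ` univ A \<subseteq> univ ?P"
        by (auto simp: product_alg_def quotient_alg_def intro: quotientI)
      show "univ ?P \<subseteq> ?h ` univ A"
      proof
        fix F assume F: "F \<in> univ ?P"
        have "\<exists>x. x \<in> univ A \<and> F i = \<theta> i `` {x}" if "i < n" for i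
          using F that by (auto simp: product_alg_def quotient_alg_def PiE_iff elim!: ballE[of _ _ i] quotientE)
        then obtain x where x: "\<And>i. i < n \<Longrightarrow> x i \<in> univ A \<and> F i = \<theta> i `` {x i}" by metis
        define y where "y = trm_op A q (c # map x [0..<n])"
        have yA: "y \<in> univ A" unfolding y_def using x by (intro dim_alg_q_closed[OF d c]) auto
        have "(y, x i) \<in> \<theta> i" if "i < n" for i
          using dim_alg_q_proj_congruence[OF d, of "map x [0..<n]" i "\<theta> i" c] that x \<theta>[OF that]
          by (auto simp: y_def \<theta>_def principal_cong_pair image_subset_iff)
        then have "?h y = F"
          using F x yA congruence_class_eq_iff[OF \<theta>]
          by (intro ext) (auto simp: product_alg_def PiE_iff extensional_def)
        then show "F \<in> ?h ` univ A" using yA by auto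
      qed
    qed
  qed
  moreover have "?h (interp A f xs) = interp ?P f (map ?h xs)"
    if "f \<in> syms \<Sigma>" "length xs = ar \<Sigma> f" "set xs \<subseteq> univ A" for f xs
    using quotient_alg_class[OF \<theta> that]
    by (auto simp: product_alg_def o_def intro!: restrict_ext)
  ultimately show ?thesis
    using d c by (auto simp: central_def Let_def is_iso_def \<theta>_def[abs_def])
qed

section \<open>Retractions onto the minimal subalgebra\<close>

locale minimal_boolean_like =
  fixes \<Sigma> :: "'f signature" and A :: "('f, 'a) alg" and n :: nat
    and q :: "'f trm" and es :: "'f trm list" and E :: "('f, 'a) alg"
  assumes n2: "n \<ge> 2" and bl: "boolean_like \<Sigma> A n q es" and E_def: "E = minimal_subalg \<Sigma> A"
    and finE: "finite (univ E)" and cardE: "card (univ E) = n"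
begin

section \<open>The constants and the minimal subalgebra\<close>

abbreviation e :: "nat \<Rightarrow> 'a" where "e i \<equiv> trm_op A (es ! i) []"

lemma dim: "dim_alg \<Sigma> A n q es"
  using bl by (simp add: boolean_like_def)

lemma alg: "is_alg \<Sigma> A"
  using dim by (simp add: dim_alg_def)

lemma subA: "subuniverse \<Sigma> A (univ A)"
  using alg by (simp add: is_alg_def)

lemma interp_closed:
  "f \<in> syms \<Sigma> \<Longrightarrow> length xs = ar \<Sigma> f \<Longrightarrow> set xs \<subseteq> univ A \<Longrightarrow> interp A f xs \<in> univ A"
  using subA by (auto simp: subuniverse_def)

lemma interp_E: "interp E = interp A"
  by (simp add: E_def minimal_subalg_def generated_subalg_def)

lemma subE: "subuniverse \<Sigma> A (univ E)"
  using subA unfolding E_def minimal_subalg_def generated_subalg_def subuniverse_def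
  by auto blast

lemma E_sub: "univ E \<subseteq> univ A"
  using subE by (auto simp: subuniverse_def)

lemma E_closed:
  "f \<in> syms \<Sigma> \<Longrightarrow> length xs = ar \<Sigma> f \<Longrightarrow> set xs \<subseteq> univ E \<Longrightarrow> interp A f xs \<in> univ E"
  using subE by (auto simp: subuniverse_def)

lemma e_E: "i < n \<Longrightarrow> e i \<in> univ E"
  using dim by (auto simp: dim_alg_def intro!: trm_op_closed[OF subE])

lemma e_A: "i < n \<Longrightarrow> e i \<in> univ A"
  using e_E E_sub by blast

lemma q_proj:
  "i < n \<Longrightarrow> length bs = n \<Longrightarrow> set bs \<subseteq> univ A \<Longrightarrow> trm_op A q (e i # bs) = bs ! i"
  using dim by (auto simp: dim_alg_def)

lemma q_closed: "c \<in> univ A \<Longrightarrow> length ws = n \<Longrightarrow> set ws \<subseteq> univ A \<Longrightarrow> trm_op A q (c # ws) \<in> univ A"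
  by (rule dim_alg_q_closed[OF dim])

text \<open>Take the tuple with \<open>x\<close> at place \<open>i\<close> and \<open>y\<close>
  elsewhere. At \<open>e i\<close> the term \<open>q\<close> returns \<open>x\<close>; since
  \<open>e i\<close> is identified with \<open>e j\<close>, the result is also congruent to
  \<open>y\<close>.\<close>

lemma congruence_total:
  assumes r: "is_congruence \<Sigma> A r" and "i < n" "j < n" "i \<noteq> j" "(e i, e j) \<in> r"
    and xy: "x \<in> univ A" "y \<in> univ A"
  shows "(x, y) \<in> r"
proof -
  let ?ws = "(replicate n y)[i := x]"
  have ws: "set ?ws \<subseteq> univ A" using xy set_update_subset_insert[of "replicate n y" i x] by auto
  have "(trm_op A q (e i # ?ws), ?ws ! j) \<in> r"
    using assms ws by (intro dim_alg_q_proj_congruence[OF dim]) auto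
  then show ?thesis using q_proj[OF \<open>i < n\<close>, of ?ws] ws assms by simp
qed

text \<open>Two equal constants would make the identity relation total and \<open>A\<close> trivial,
  whereas \<open>E\<close> has at least two elements.\<close>

lemma e_inj: "inj_on e {..<n}"
proof (rule inj_onI, rule ccontr)
  fix i j assume ij: "i \<in> {..<n}" "j \<in> {..<n}" "e i = e j" "i \<noteq> j"
  have "x = y" if "x \<in> univ A" "y \<in> univ A" for x y
    using congruence_total[OF is_congruence_Id_on[OF alg], of i j x y] ij that e_A
    by (auto simp: Id_on_iff)
  then have "univ E \<subseteq> {e 0}" using E_sub e_A[of 0] n2 by auto
  then have "card (univ E) \<le> 1" using card_mono[of "{e 0}" "univ E"] by simp
  then show False using cardE n2 by simp
qed

text \<open>By \<open>e_inj\<close> the constants are already \<open>n\<close> elements of a set of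
  cardinality \<open>n\<close>.\<close>

lemma E_eq: "univ E = e ` {..<n}"
proof -
  have "e ` {..<n} \<subseteq> univ E" using e_E by auto
  moreover have "card (e ` {..<n}) = n" using e_inj by (simp add: card_image)
  ultimately show ?thesis using finE cardE card_subset_eq by metis
qed

lemma e_eq_iff: "i < n \<Longrightarrow> j < n \<Longrightarrow> e i = e j \<longleftrightarrow> i = j"
  using e_inj by (metis inj_on_eq_iff lessThan_iff)

text \<open>Values outside \<open>univ A\<close> are left free, so one retraction can be given by
  several functions; only the values on \<open>univ A\<close> matter.\<close>

definition X :: "('a \<Rightarrow> 'a) set" where
  "X = {h. (\<forall>x\<in>univ A. h x \<in> univ E) \<and> (\<forall>x\<in>univ E. h x = x) \<and>
     (\<forall>f\<in>syms \<Sigma>. \<forall>xs. length xs = ar \<Sigma> f \<and> set xs \<subseteq> univ A \<longrightarrow>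
        h (interp A f xs) = interp A f (map h xs))}"

lemma X_E: "h \<in> X \<Longrightarrow> x \<in> univ A \<Longrightarrow> h x \<in> univ E"
  by (simp add: X_def)

lemma X_id: "h \<in> X \<Longrightarrow> x \<in> univ E \<Longrightarrow> h x = x"
  by (simp add: X_def)

lemma X_hom:
  "h \<in> X \<Longrightarrow> f \<in> syms \<Sigma> \<Longrightarrow> length xs = ar \<Sigma> f \<Longrightarrow> set xs \<subseteq> univ A \<Longrightarrow>
    h (interp A f xs) = interp A f (map h xs)"
  by (simp add: X_def)

text \<open>A retraction commutes with \<open>q\<close> and sends \<open>c\<close> to a constant, so
  under it \<open>q\<close> becomes a case distinction on \<open>h c\<close>.\<close>

lemma X_q:
  assumes "h \<in> X" "c \<in> univ A" "length ws = n" "set ws \<subseteq> univ A" "i < n" "h c = e i"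
  shows "h (trm_op A q (c # ws)) = h (ws ! i)"
proof -
  have "trm_in \<Sigma> (length (c # ws)) q" using dim assms by (simp add: dim_alg_def)
  then have "h (trm_op A q (c # ws)) = trm_op A q (map h (c # ws))"
    using assms by (intro trm_op_hom[OF subA X_hom[OF assms(1)]]) auto
  also have "\<dots> = map h ws ! i"
    using assms X_E[OF assms(1)] E_sub by (simp only: list.map, intro q_proj) auto
  finally show ?thesis using assms by simp
qed

text \<open>The decomposition induced by a central \<open>c\<close> splits a congruence \<open>\<phi>\<close> into congruences
  \<open>\<phi>\<^sub>i\<close> above \<open>\<phi>\<close> with intersection \<open>\<phi>\<close> and \<open>(c, e\<^sub>i) \<in> \<phi>\<^sub>i\<close>.\<close>

lemma congruence_split:
  assumes \<phi>: "is_congruence \<Sigma> A \<phi>" and ab: "(a, b) \<notin> \<phi>" "a \<in> univ A" "b \<in> univ A"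
    and c: "c \<in> univ A"
  obtains i \<psi> where "i < n" "is_congruence \<Sigma> A \<psi>" "\<phi> \<subseteq> \<psi>" "(a, b) \<notin> \<psi>" "(c, e i) \<in> \<psi>"
proof -
  have cen: "central \<Sigma> A n q es c" using bl c by (simp add: boolean_like_def)
  define \<theta> where "\<theta> i = principal_cong \<Sigma> A c (e i)" for i
  have \<theta>: "is_congruence \<Sigma> A (\<theta> i)" if "i < n" for i
    using that e_A alg c unfolding \<theta>_def by (intro principal_cong_congruence) auto
  \<comment> \<open>The element \<open>P i x\<close> has the i-th coordinate of \<open>x\<close>,
    while its other coordinates are those of \<open>e 0\<close> and do not depend on
    \<open>x\<close>.\<close>
  define w where "w i x = (replicate n (e 0))[i := x]" for i x
  define P where "P i x = trm_op A q (c # w i x)" for i x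
  have w: "length (w i x) = n" "x \<in> univ A \<Longrightarrow> set (w i x) \<subseteq> univ A" for i x
    using set_update_subset_insert[of "replicate n (e 0)" i x] e_A[of 0] n2
    by (auto simp: w_def)
  have P_closed: "P i x \<in> univ A" if "x \<in> univ A" for i x
    unfolding P_def using that by (intro q_closed c w)
  have P_\<theta>: "(P i x, w i x ! j) \<in> \<theta> j" if "x \<in> univ A" "j < n" for i j x
    using central_eq_iff[OF cen w(1) w(2)[OF that(1)] P_closed[OF that(1)]] that
    by (auto simp: P_def \<theta>_def)
  \<comment> \<open>\<open>P i y\<close> is the unique solution of the congruences given by
    \<open>w i y\<close>, and \<open>P i x\<close> solves them too once \<open>x\<close> and
    \<open>y\<close> agree modulo \<open>\<theta> i\<close>.\<close>
  have P_eqI: "P i x = P i y" if "(x, y) \<in> \<theta> i" "i < n" for i x y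
  proof -
    have xy: "x \<in> univ A" "y \<in> univ A" using congruence_dom[OF \<theta>] that by blast+
    have "(P i x, w i y ! j) \<in> \<theta> j" if "j < n" for j
    proof (cases "j = i")
      case True
      then have "(P i x, x) \<in> \<theta> i" using P_\<theta>[OF xy(1) that, of i] that by (simp add: w_def)
      then show ?thesis
        using True \<open>(x, y) \<in> \<theta> i\<close> congruence_trans[OF \<theta>[OF \<open>i < n\<close>]] that by (simp add: w_def)
    next
      case False
      then show ?thesis using P_\<theta>[OF xy(1) that, of i] by (simp add: w_def)
    qed
    then show ?thesis
      using central_eq_iff[OF cen w(1) w(2)[OF xy(2)] P_closed[OF xy(1)]] by (auto simp: P_def \<theta>_def)
  qed
  have P_\<phi>: "(P i x, P i y) \<in> \<phi>" if "(x, y) \<in> \<phi>" for i x y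
    unfolding P_def using that congruence_refl[OF \<phi>] c e_A[of 0] n2
    by (intro dim_alg_q_congruence[OF dim w(1) \<phi>]) (auto simp: w_def list_all2_same intro!: list_all2_update_cong)
  have P_self: "(P i x, x) \<in> \<theta> i" if "x \<in> univ A" "i < n" for i x
    using P_\<theta>[OF that, of i] that by (simp add: w_def)
  \<comment> \<open>Two elements are related when their i-th coordinates, padded by
    \<open>P i\<close>, agree modulo \<open>\<phi>\<close>.\<close>
  define \<psi> where "\<psi> i = {(x, y). x \<in> univ A \<and> y \<in> univ A \<and> (P i x, P i y) \<in> \<phi>}" for i
  have \<psi>: "is_congruence \<Sigma> A (\<psi> i)" if "i < n" for i
  proof (rule is_congruenceI)
    fix f xs ys
    assume f: "f \<in> syms \<Sigma>" "length xs = ar \<Sigma> f" "list_all2 (\<lambda>x y. (x, y) \<in> \<psi> i) xs ys"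
      and xs: "set xs \<subseteq> univ A" and ys: "set ys \<subseteq> univ A"
    have len: "length ys = ar \<Sigma> f" using f list_all2_lengthD by force
    \<comment> \<open>Applying \<open>P i\<close> to the arguments keeps the value in its class
      modulo \<open>\<theta> i\<close>, which is all that \<open>P i\<close> sees. This reduces
      compatibility of \<open>\<psi> i\<close> to that of \<open>\<phi>\<close>.\<close>
    have P_op: "P i (interp A f zs) = P i (interp A f (map (P i) zs))"
      if "length zs = ar \<Sigma> f" "set zs \<subseteq> univ A" for zs
    proof -
      have "(interp A f (map (P i) zs), interp A f zs) \<in> \<theta> i"
        using that f P_self[OF _ \<open>i < n\<close>]
        by (intro congruence_op[OF \<theta>[OF \<open>i < n\<close>]]) (auto simp: list_all2_conv_all_nth subset_iff)
      then show ?thesis using P_eqI \<open>i < n\<close> by metis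
    qed
    have "(interp A f (map (P i) xs), interp A f (map (P i) ys)) \<in> \<phi>"
      using f by (intro congruence_op[OF \<phi>]) (auto simp: list_all2_conv_all_nth \<psi>_def)
    then show "(interp A f xs, interp A f ys) \<in> \<psi> i"
      using P_\<phi> P_op xs ys len f interp_closed by (simp add: \<psi>_def)
  qed (auto simp: \<psi>_def intro: congruence_refl[OF \<phi>] congruence_sym[OF \<phi>] congruence_trans[OF \<phi>] P_closed)
  \<comment> \<open>Every \<open>x\<close> is reassembled by \<open>q\<close> from its components
    \<open>P i x\<close>. If all components of \<open>a\<close> and \<open>b\<close> were congruent
    modulo \<open>\<phi>\<close>, so would be \<open>a\<close> and \<open>b\<close>.\<close>
  have "\<exists>i<n. (a, b) \<notin> \<psi> i"
  proof (rule ccontr)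
    assume "\<not> (\<exists>i<n. (a, b) \<notin> \<psi> i)"
    then have ab': "(P i a, P i b) \<in> \<phi>" if "i < n" for i using that by (auto simp: \<psi>_def)
    have eq: "x = trm_op A q (c # map (\<lambda>i. P i x) [0..<n])" if "x \<in> univ A" for x
    proof -
      have "\<forall>i<n. (x, map (\<lambda>i. P i x) [0..<n] ! i) \<in> \<theta> i"
        using P_self[OF that] congruence_sym[OF \<theta>] by simp
      then show ?thesis
        using central_eq_iff[OF cen, of "map (\<lambda>i. P i x) [0..<n]" x] that P_closed
        by (auto simp: \<theta>_def)
    qed
    have "(trm_op A q (c # map (\<lambda>i. P i a) [0..<n]), trm_op A q (c # map (\<lambda>i. P i b) [0..<n])) \<in> \<phi>"
      using ab' congruence_refl[OF \<phi> c]
      by (intro dim_alg_q_congruence[OF dim _ \<phi>]) (auto simp: list_all2_conv_all_nth)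
    then show False using eq ab by metis
  qed
  then obtain i where i: "i < n" "(a, b) \<notin> \<psi> i" by blast
  moreover have "\<phi> \<subseteq> \<psi> i" using P_\<phi> congruence_dom[OF \<phi>] by (auto simp: \<psi>_def)
  moreover have "(c, e i) \<in> \<psi> i"
    using P_eqI[of c "e i" i] i c e_A congruence_refl[OF \<phi>] P_closed
    by (auto simp: \<psi>_def \<theta>_def principal_cong_pair)
  ultimately show ?thesis using that \<psi> by blast
qed

text \<open>The start congruence lets one Zorn argument serve twice: the identity yields separation
  of points, and a congruence made from finite subsets yields compactness.\<close>

lemma exists_retraction:
  assumes \<phi>0: "is_congruence \<Sigma> A \<phi>0" and ab: "(a, b) \<notin> \<phi>0" "a \<in> univ A" "b \<in> univ A"
  obtains h where "h \<in> X" "\<And>x y. (x, y) \<in> \<phi>0 \<Longrightarrow> h x = h y" "h a \<noteq> h b"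
proof -
  let ?C = "{r. is_congruence \<Sigma> A r \<and> \<phi>0 \<subseteq> r \<and> (a, b) \<notin> r}"
  have "\<exists>\<phi>\<in>?C. \<forall>r\<in>?C. \<phi> \<subseteq> r \<longrightarrow> r = \<phi>"
  proof (rule subset_Zorn_nonempty)
    show "?C \<noteq> {}" using assms by blast
  next
    fix \<C> assume ne: "\<C> \<noteq> {}" and ch: "subset.chain ?C \<C>"
    have mem: "r \<in> ?C" if "r \<in> \<C>" for r using ch that by (auto simp: subset.chain_def)
    \<comment> \<open>Arities are finite and the chain is linearly ordered, so finitely many pairs
      from the union lie in a single member.\<close>
    have list: "\<exists>r\<in>\<C>. list_all2 (\<lambda>x y. (x, y) \<in> r) xs ys"
      if "list_all2 (\<lambda>x y. (x, y) \<in> \<Union>\<C>) xs ys" for xs ys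
      using that
    proof (induction rule: list_all2_induct)
      case Nil
      then show ?case using ne by auto
    next
      case (Cons x xs y ys)
      then obtain r s where rs: "r \<in> \<C>" "list_all2 (\<lambda>x y. (x, y) \<in> r) xs ys" "s \<in> \<C>" "(x, y) \<in> s"
        by blast
      then consider "r \<subseteq> s" | "s \<subseteq> r" using ch by (auto simp: subset_chain_def)
      then show ?case
        using rs by cases (force intro!: bexI[of _ s] elim: list_all2_mono, force intro!: bexI[of _ r])
    qed
    have "is_congruence \<Sigma> A (\<Union>\<C>)"
    proof (rule is_congruenceI)
      show "\<Union>\<C> \<subseteq> univ A \<times> univ A" using mem congruence_dom by fast
      show "(x, x) \<in> \<Union>\<C>" if "x \<in> univ A" for x using ne mem that congruence_refl by fast
      show "(y, x) \<in> \<Union>\<C>" if "(x, y) \<in> \<Union>\<C>" for x y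
        using that mem congruence_sym by fast
    next
      fix x y z assume "(x, y) \<in> \<Union>\<C>" "(y, z) \<in> \<Union>\<C>"
      then obtain r where "r \<in> \<C>" "(x, y) \<in> r" "(y, z) \<in> r"
        using list[of "[x, y]" "[y, z]"] by auto
      then show "(x, z) \<in> \<Union>\<C>" using mem congruence_trans by fast
    next
      fix f xs ys
      assume *: "f \<in> syms \<Sigma>" "length xs = ar \<Sigma> f" "list_all2 (\<lambda>x y. (x, y) \<in> \<Union>\<C>) xs ys"
      obtain r where "r \<in> \<C>" "list_all2 (\<lambda>x y. (x, y) \<in> r) xs ys" using list[OF *(3)] by metis
      then show "(interp A f xs, interp A f ys) \<in> \<Union>\<C>" using mem congruence_op * by fast
    qed
    then show "\<Union>\<C> \<in> ?C" using mem ne by auto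
  qed
  then obtain \<phi> where \<phi>: "is_congruence \<Sigma> A \<phi>" "\<phi>0 \<subseteq> \<phi>" "(a, b) \<notin> \<phi>"
    and max: "\<And>r. is_congruence \<Sigma> A r \<Longrightarrow> (a, b) \<notin> r \<Longrightarrow> \<phi> \<subseteq> r \<Longrightarrow> r = \<phi>"
    by (force simp del: Union_iff)
  \<comment> \<open>The congruence obtained from the splitting contains \<open>\<phi>\<close> and
    still omits \<open>(a, b)\<close>, so it is \<open>\<phi>\<close> itself and \<open>c\<close> is
    already congruent to a constant.\<close>
  have ex: "\<exists>d\<in>univ E. (c, d) \<in> \<phi>" if "c \<in> univ A" for c
    using congruence_split[OF \<phi>(1,3) ab(2,3) that] max e_E by metis
  \<comment> \<open>Identifying two different constants would make \<open>\<phi>\<close> total, and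
    then it would contain \<open>(a, b)\<close>.\<close>
  have uniq: "d = d'" if d: "d \<in> univ E" "d' \<in> univ E" "(d, d') \<in> \<phi>" for d d'
  proof (rule ccontr)
    assume "d \<noteq> d'"
    then obtain i j where "i < n" "j < n" "i \<noteq> j" "d = e i" "d' = e j"
      using d by (auto simp: E_eq)
    then show False using congruence_total[OF \<phi>(1)] d \<phi>(3) ab by blast
  qed
  define h where "h c = (SOME d. d \<in> univ E \<and> (c, d) \<in> \<phi>)" for c
  have h: "h c \<in> univ E" "(c, h c) \<in> \<phi>" if "c \<in> univ A" for c
    using someI_ex[of "\<lambda>d. d \<in> univ E \<and> (c, d) \<in> \<phi>"] ex[OF that] unfolding h_def by blast+
  have h_eq: "h c = d" if "d \<in> univ E" "(c, d) \<in> \<phi>" for c d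
    using that h uniq congruence_dom[OF \<phi>(1)] congruence_sym[OF \<phi>(1)] congruence_trans[OF \<phi>(1)] by meson
  have "h \<in> X"
    unfolding X_def
  proof (intro CollectI conjI ballI allI impI)
    show "h x = x" if "x \<in> univ E" for x
      using that E_sub congruence_refl[OF \<phi>(1)] by (intro h_eq) auto
  next
    fix f xs assume f: "f \<in> syms \<Sigma>" "length xs = ar \<Sigma> f \<and> set xs \<subseteq> univ A"
    show "h (interp A f xs) = interp A f (map h xs)"
    proof (rule h_eq)
      show "interp A f (map h xs) \<in> univ E" using f h by (intro E_closed) auto
      show "(interp A f xs, interp A f (map h xs)) \<in> \<phi>"
        using f h by (intro congruence_op[OF \<phi>(1)]) (auto simp: list_all2_conv_all_nth subset_iff)
    qed
  qed (use h in auto)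
  moreover have "h x = h y \<longleftrightarrow> (x, y) \<in> \<phi>" if "x \<in> univ A" "y \<in> univ A" for x y
    using that h h_eq congruence_sym[OF \<phi>(1)] congruence_trans[OF \<phi>(1)] by metis
  ultimately show ?thesis using that \<phi> ab congruence_dom[OF \<phi>0] by blast
qed

section \<open>Separation and compactness for the retractions\<close>

lemma X_separates:
  assumes "x \<in> univ A" "y \<in> univ A" "\<And>h. h \<in> X \<Longrightarrow> h x = h y"
  shows "x = y"
proof (rule ccontr)
  assume "x \<noteq> y"
  then have "(x, y) \<notin> Id_on (univ A)" by auto
  then obtain h where "h \<in> X" "h x \<noteq> h y"
    using exists_retraction[OF is_congruence_Id_on[OF alg] _ assms(1,2)] by metis
  then show False using assms(3) by blast
qed

text \<open>For finite \<open>T\<close>, the relation \<open>r T\<close> is equality under all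
  retractions that send \<open>T\<close> to \<open>e 0\<close>. The directed union
  \<open>\<phi>\<close> of these congruences identifies every element of \<open>S\<close> with
  \<open>e 0\<close>, so any retraction that factors through \<open>\<phi>\<close> is as
  required.\<close>

lemma X_compact:
  assumes S: "S \<subseteq> univ A" and fip: "\<And>T. finite T \<Longrightarrow> T \<subseteq> S \<Longrightarrow> \<exists>h\<in>X. \<forall>b\<in>T. h b = e 0"
  shows "\<exists>h\<in>X. \<forall>b\<in>S. h b = e 0"
proof -
  define r where "r T = {(x, y). x \<in> univ A \<and> y \<in> univ A \<and> (\<forall>h\<in>X. (\<forall>b\<in>T. h b = e 0) \<longrightarrow> h x = h y)}" for T
  define \<phi> where "\<phi> = (\<Union>T\<in>{T. finite T \<and> T \<subseteq> S}. r T)"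
  have r_mono: "r T \<subseteq> r T'" if "T \<subseteq> T'" for T T' using that by (auto simp: r_def)
  \<comment> \<open>The relations \<open>r T\<close> are directed under unions of finite sets, so
    the finitely many pairs of one argument list share a single \<open>T\<close>.\<close>
  have list: "\<exists>T. finite T \<and> T \<subseteq> S \<and> list_all2 (\<lambda>x y. (x, y) \<in> r T) xs ys"
    if "list_all2 (\<lambda>x y. (x, y) \<in> \<phi>) xs ys" for xs ys
    using that
  proof (induction rule: list_all2_induct)
    case Nil
    then show ?case by auto
  next
    case (Cons x xs y ys)
    then obtain T T' where T: "finite T" "T \<subseteq> S" "(x, y) \<in> r T" "finite T'" "T' \<subseteq> S"
        "list_all2 (\<lambda>x y. (x, y) \<in> r T') xs ys"
      by (auto simp: \<phi>_def)
    then show ?case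
      using r_mono[of T "T \<union> T'"] r_mono[of T' "T \<union> T'"]
      by (intro exI[of _ "T \<union> T'"]) (auto elim: list_all2_mono)
  qed
  have "is_congruence \<Sigma> A \<phi>"
  proof (rule is_congruenceI)
    show "\<phi> \<subseteq> univ A \<times> univ A" by (auto simp: \<phi>_def r_def)
    show "(x, x) \<in> \<phi>" if "x \<in> univ A" for x using that by (auto simp: \<phi>_def r_def)
    show "(y, x) \<in> \<phi>" if "(x, y) \<in> \<phi>" for x y
      using that unfolding \<phi>_def r_def by fastforce
  next
    fix x y z assume "(x, y) \<in> \<phi>" "(y, z) \<in> \<phi>"
    then obtain T where T: "finite T" "T \<subseteq> S" "(x, y) \<in> r T" "(y, z) \<in> r T"
      using list[of "[x, y]" "[y, z]"] by auto
    then have "(x, z) \<in> r T" by (auto simp: r_def)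
    then show "(x, z) \<in> \<phi>" using T by (auto simp: \<phi>_def)
  next
    fix f xs ys
    assume *: "f \<in> syms \<Sigma>" "length xs = ar \<Sigma> f" "list_all2 (\<lambda>x y. (x, y) \<in> \<phi>) xs ys"
      "set xs \<subseteq> univ A" "set ys \<subseteq> univ A"
    obtain T where T: "finite T" "T \<subseteq> S" "list_all2 (\<lambda>x y. (x, y) \<in> r T) xs ys"
      using list[OF *(3)] by metis
    have len: "length ys = ar \<Sigma> f" using * list_all2_lengthD by force
    have "h (interp A f xs) = h (interp A f ys)" if "h \<in> X" "\<forall>b\<in>T. h b = e 0" for h
    proof -
      have "map h xs = map h ys"
        using T(3) that by (auto simp: r_def list_all2_conv_all_nth intro!: nth_equalityI)
      then show ?thesis using X_hom * len that by metis
    qed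
    then have "(interp A f xs, interp A f ys) \<in> r T"
      using * len interp_closed by (auto simp: r_def)
    then show "(interp A f xs, interp A f ys) \<in> \<phi>" using T by (auto simp: \<phi>_def)
  qed
  \<comment> \<open>Such a pair would lie in \<open>r T\<close> for one finite \<open>T\<close>; the
    retraction that the assumption supplies for \<open>T\<close> fixes both constants and keeps them
    apart.\<close>
  moreover have "(e 0, e 1) \<notin> \<phi>"
  proof
    assume "(e 0, e 1) \<in> \<phi>"
    then obtain T where "finite T" "T \<subseteq> S" "(e 0, e 1) \<in> r T" by (auto simp: \<phi>_def)
    moreover obtain h where "h \<in> X" "\<forall>b\<in>T. h b = e 0" using fip calculation by blast
    ultimately have "h (e 0) = h (e 1)" by (simp add: r_def)
    then show False
      using X_id[OF \<open>h \<in> X\<close>] e_E[of 0] e_E[of 1] e_eq_iff[of 0 1] n2 by simp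
  qed
  moreover have "(b, e 0) \<in> \<phi>" if "b \<in> S" for b
    unfolding \<phi>_def using that S e_A[of 0] n2 e_E[of 0]
    by (intro UN_I[of "{b}"]) (auto simp: r_def X_id)
  ultimately show ?thesis
    using exists_retraction[of \<phi> "e 0" "e 1"] e_A[of 0] e_A[of 1] n2 X_id e_E[of 0]
    by (metis One_nat_def Suc_1 Suc_le_lessD order_less_trans zero_less_one)
qed

section \<open>The Boolean algebra and coordinates\<close>

text \<open>The list of constants is indexed from 0: \<open>lo\<close> is the first constant, the
  Boolean zero, and \<open>hi\<close> the second one, the Boolean unit.\<close>

definition lo :: 'a where "lo = e 0"
definition hi :: 'a where "hi = e 1"

abbreviation B :: "'a bool_alg" where "B \<equiv> B_alg A q es"
abbreviation R :: "'a ring" where "R \<equiv> semiring_of B"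
abbreviation p :: "'a \<Rightarrow> 'a \<Rightarrow> 'a \<Rightarrow> 'a" where "p \<equiv> p_op A q es"

lemma lo_hi: "lo \<in> univ E" "hi \<in> univ E" "lo \<in> univ A" "hi \<in> univ A" "lo \<noteq> hi" "hi \<noteq> lo"
  using e_E[of 0] e_E[of 1] e_A[of 0] e_A[of 1] e_eq_iff[of 0 1] n2 by (auto simp: lo_def hi_def)

lemma X_lo_hi: "h \<in> X \<Longrightarrow> h lo = lo" "h \<in> X \<Longrightarrow> h hi = hi"
  by (simp_all add: X_id lo_hi)

section \<open>The ternary term and the carrier of the Boolean algebra\<close>

lemma p_args:
  assumes "y \<in> univ A" "z \<in> univ A"
  shows "length ([y, z] @ map (\<lambda>t. trm_op A t []) (drop 2 es)) = n"
    "set ([y, z] @ map (\<lambda>t. trm_op A t []) (drop 2 es)) \<subseteq> univ A"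
proof -
  have len: "length es = n" using dim by (simp add: dim_alg_def)
  then show "length ([y, z] @ map (\<lambda>t. trm_op A t []) (drop 2 es)) = n" using n2 by simp
  have "trm_op A t [] \<in> univ A" if "t \<in> set (drop 2 es)" for t
  proof -
    have "t \<in> set es" using that by (meson in_set_dropD)
    then show ?thesis using e_A len by (metis in_set_conv_nth)
  qed
  then show "set ([y, z] @ map (\<lambda>t. trm_op A t []) (drop 2 es)) \<subseteq> univ A" using assms by auto
qed

lemma p_closed: "x \<in> univ A \<Longrightarrow> y \<in> univ A \<Longrightarrow> z \<in> univ A \<Longrightarrow> p x y z \<in> univ A"
  unfolding p_op_def using q_closed[OF _ p_args] by simp

lemma X_p_nth:
  assumes "h \<in> X" "x \<in> univ A" "y \<in> univ A" "z \<in> univ A" "i < n" "h x = e i"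
  shows "h (p x y z) = h (([y, z] @ map (\<lambda>t. trm_op A t []) (drop 2 es)) ! i)"
  unfolding p_op_def using X_q[OF assms(1,2) p_args[OF assms(3,4)] assms(5,6)] by simp

text \<open>From index 2 on, \<open>p\<close> is padded with the constants themselves, so a value
  \<open>e i\<close> of \<open>h x\<close> selects \<open>e i\<close> again.\<close>

lemma X_p:
  assumes "h \<in> X" "x \<in> univ A" "y \<in> univ A" "z \<in> univ A"
  shows "h x = lo \<Longrightarrow> h (p x y z) = h y" "h x = hi \<Longrightarrow> h (p x y z) = h z"
    "h x \<noteq> lo \<Longrightarrow> h x \<noteq> hi \<Longrightarrow> h (p x y z) = h x"
proof -
  show "h (p x y z) = h y" if "h x = lo"
    using X_p_nth[OF assms, of 0] that n2 by (simp add: lo_def)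
  show "h (p x y z) = h z" if "h x = hi"
    using X_p_nth[OF assms, of 1] that n2 by (simp add: hi_def)
  show "h (p x y z) = h x" if "h x \<noteq> lo" "h x \<noteq> hi"
  proof -
    obtain i where i: "i < n" "h x = e i" using X_E[OF assms(1,2)] by (auto simp: E_eq)
    then have "i \<noteq> 0" "i \<noteq> 1" using that unfolding lo_def hi_def by metis+
    then obtain k where k: "i = Suc (Suc k)" by (metis One_nat_def not0_implies_Suc)
    have "length es = n" using dim by (simp add: dim_alg_def)
    then have "h (p x y z) = h (e i)" using X_p_nth[OF assms i] i k by (simp add: numeral_2_eq_2)
    then show ?thesis using X_id[OF assms(1) e_E[OF i(1)]] i by simp
  qed
qed

text \<open>At a retraction where \<open>x\<close> has a third value, \<open>p x lo lo\<close> takes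
  that value instead of \<open>lo\<close>. At the two Boolean values, \<open>p x y y\<close> selects
  \<open>y\<close> either way.\<close>

lemma carrier_B: "carrier B = {x \<in> univ A. \<forall>h\<in>X. h x = lo \<or> h x = hi}"
proof -
  have "(\<forall>y\<in>univ A. p x y y = y) \<longleftrightarrow> (\<forall>h\<in>X. h x = lo \<or> h x = hi)" if x: "x \<in> univ A" for x
  proof
    assume *: "\<forall>y\<in>univ A. p x y y = y"
    show "\<forall>h\<in>X. h x = lo \<or> h x = hi"
    proof (rule ballI, rule ccontr)
      fix h assume h: "h \<in> X" and "\<not> (h x = lo \<or> h x = hi)"
      then have "h (p x lo lo) = h x" using X_p(3)[OF h x lo_hi(3,3)] by simp
      then show False using * lo_hi X_lo_hi[OF h] \<open>\<not> _\<close> by simp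
    qed
  next
    assume *: "\<forall>h\<in>X. h x = lo \<or> h x = hi"
    show "\<forall>y\<in>univ A. p x y y = y"
    proof
      fix y assume y: "y \<in> univ A"
      show "p x y y = y"
      proof (rule X_separates)
        show "h (p x y y) = h y" if "h \<in> X" for h using X_p(1,2)[OF that x y y] * that by blast
      qed (use x y p_closed in auto)
    qed
  qed
  then show ?thesis by (auto simp: B_alg_def Let_def)
qed

lemma B_A: "b \<in> carrier B \<Longrightarrow> b \<in> univ A"
  by (simp add: carrier_B)

lemma X_B: "h \<in> X \<Longrightarrow> b \<in> carrier B \<Longrightarrow> h b \<noteq> hi \<longleftrightarrow> h b = lo"
  using lo_hi by (auto simp: carrier_B)

text \<open>With only two possible values, the retractions giving \<open>hi\<close> decide
  everything; identities of \<open>B\<close> thus become identities between subsets of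
  \<open>X\<close>.\<close>

lemma B_eqI:
  assumes "x \<in> carrier B" "y \<in> carrier B" "\<And>h. h \<in> X \<Longrightarrow> h x = hi \<longleftrightarrow> h y = hi"
  shows "x = y"
proof (rule X_separates)
  show "h x = h y" if "h \<in> X" for h using assms that X_B[OF that] by metis
qed (use assms B_A in auto)

lemma B_simps: "meet B x y = p x lo y" "join B x y = p x y hi" "compl B x = p x hi lo"
  "bottom B = lo" "unit B = hi"
  by (simp_all add: B_alg_def Let_def lo_def hi_def)

lemma R_simps: "carrier R = carrier B" "x \<otimes>\<^bsub>R\<^esub> y = meet B x y" "x \<oplus>\<^bsub>R\<^esub> y = join B x y"
  "\<zero>\<^bsub>R\<^esub> = lo" "\<one>\<^bsub>R\<^esub> = hi"
  by (simp_all add: semiring_of_def B_simps)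

lemma X_B_ops:
  assumes h: "h \<in> X" and x: "x \<in> carrier B" and y: "y \<in> carrier B"
  shows "h (meet B x y) = hi \<longleftrightarrow> h x = hi \<and> h y = hi"
    "h (join B x y) = hi \<longleftrightarrow> h x = hi \<or> h y = hi"
    "h (compl B x) = hi \<longleftrightarrow> h x \<noteq> hi"
  using X_B[OF h x] X_B[OF h y] X_p(1,2)[OF h B_A[OF x] lo_hi(3) B_A[OF y]]
    X_p(1,2)[OF h B_A[OF x] B_A[OF y] lo_hi(4)] X_p(1,2)[OF h B_A[OF x] lo_hi(4,3)]
    lo_hi(5) X_lo_hi[OF h]
  unfolding B_simps by metis+

lemma lo_hi_B: "lo \<in> carrier B" "hi \<in> carrier B"
  by (auto simp: carrier_B lo_hi X_lo_hi)

lemma B_closed: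
  assumes "x \<in> carrier B" "y \<in> carrier B"
  shows "meet B x y \<in> carrier B" "join B x y \<in> carrier B"
    and "compl B x \<in> carrier B"
proof -
  have "h (p b y z) = lo \<or> h (p b y z) = hi"
    if "h \<in> X" "b \<in> carrier B" "y \<in> carrier B" "z \<in> carrier B" for h b y z
    using that X_p(1,2)[OF that(1), of b y z] unfolding carrier_B mem_Collect_eq by metis
  then have "p b y z \<in> carrier B" if "b \<in> carrier B" "y \<in> carrier B" "z \<in> carrier B" for b y z
    using that p_closed by (simp add: carrier_B)
  then show "meet B x y \<in> carrier B" "join B x y \<in> carrier B" "compl B x \<in> carrier B"
    using assms lo_hi_B by (simp_all add: B_simps)
qed

text \<open>The record \<open>ring\<close> carries a semiring here; its additive monoid is what the
  laws of \<open>finsum\<close> require.\<close>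

lemma abelian_monoid_R: "abelian_monoid R"
proof (rule abelian_monoidI; unfold R_simps)
  fix x y z assume *: "x \<in> carrier B" "y \<in> carrier B" "z \<in> carrier B"
  show "join B (join B x y) z = join B x (join B y z)"
    using * by (intro B_eqI) (simp_all add: X_B_ops B_closed)
next
  fix x y assume *: "x \<in> carrier B" "y \<in> carrier B"
  show "join B x y = join B y x"
    using * by (intro B_eqI) (auto simp add: X_B_ops B_closed)
next
  fix x assume *: "x \<in> carrier B"
  show "join B lo x = x"
    using * by (intro B_eqI) (simp_all add: X_B_ops B_closed lo_hi_B X_lo_hi lo_hi)
qed (simp_all add: B_closed lo_hi_B)

text \<open>Addition is \<open>join\<close>, so a retraction turns a finite sum into an existential
  statement; likewise \<open>X_foldr\<close> turns a product into a universal one.\<close>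

lemma X_finsum:
  assumes "h \<in> X" "finite S" "\<And>s. s \<in> S \<Longrightarrow> f s \<in> carrier B"
  shows "finsum R f S \<in> carrier B \<and> (h (finsum R f S) = hi \<longleftrightarrow> (\<exists>s\<in>S. h (f s) = hi))"
  using assms(2,3)
proof (induction S)
  case empty
  then show ?case
    using abelian_monoid.finsum_empty[OF abelian_monoid_R, of f] assms(1)
    by (simp add: R_simps lo_hi_B X_lo_hi lo_hi)
next
  case (insert s S)
  then have "finsum R f (insert s S) = f s \<oplus>\<^bsub>R\<^esub> finsum R f S"
    by (intro abelian_monoid.finsum_insert[OF abelian_monoid_R]) (auto simp: R_simps)
  then show ?case using insert assms(1) by (auto simp: R_simps X_B_ops intro!: B_closed)
qed

lemma finsum_closed:
  assumes "finite S" "\<And>s. s \<in> S \<Longrightarrow> f s \<in> carrier B"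
  shows "finsum R f S \<in> carrier B"
  using abelian_monoid.finsum_closed[OF abelian_monoid_R, of f S] assms by (auto simp: R_simps)

lemma X_foldr:
  assumes "set xs \<subseteq> carrier B"
  shows "foldr (\<lambda>x y. x \<otimes>\<^bsub>R\<^esub> y) xs \<one>\<^bsub>R\<^esub> \<in> carrier B \<and>
    (\<forall>h\<in>X. h (foldr (\<lambda>x y. x \<otimes>\<^bsub>R\<^esub> y) xs \<one>\<^bsub>R\<^esub>) = hi \<longleftrightarrow> (\<forall>x\<in>set xs. h x = hi))"
  using assms by (induction xs) (auto simp: R_simps lo_hi_B X_lo_hi X_B_ops intro: B_closed)

text \<open>Under a retraction \<open>q\<close> reads the slot selected by \<open>h c\<close>, and
  the only slot holding \<open>hi\<close> is the position of \<open>d\<close> among the constants.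
  The value \<open>lo\<close> outside \<open>E\<close> follows the convention for vectors.\<close>

definition coord :: "'a \<Rightarrow> 'a \<Rightarrow> 'a" where
  "coord c d = (if d \<in> univ E
     then trm_op A q (c # (replicate n lo)[inv_into {..<n} e d := hi]) else lo)"

lemma coord_value:
  assumes c: "c \<in> univ A" and d: "d \<in> univ E"
  shows "coord c d \<in> univ A" "\<And>h. h \<in> X \<Longrightarrow> h (coord c d) = (if h c = d then hi else lo)"
proof -
  let ?k = "inv_into {..<n} e d"
  let ?ws = "(replicate n lo)[?k := hi]"
  have k: "?k < n" "e ?k = d"
    using d inv_into_into[of d e "{..<n}"] f_inv_into_f[of d e "{..<n}"] by (auto simp: E_eq)
  have ws: "set ?ws \<subseteq> univ A"
    using set_update_subset_insert[of "replicate n lo" ?k hi] lo_hi by auto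
  show "coord c d \<in> univ A" using d q_closed[OF c _ ws] by (simp add: coord_def)
  fix h assume h: "h \<in> X"
  obtain i where i: "i < n" "h c = e i" using X_E[OF h c] by (auto simp: E_eq)
  have "h (coord c d) = h (?ws ! i)" using X_q[OF h c _ ws i] d by (simp add: coord_def)
  also have "\<dots> = (if i = ?k then hi else lo)" using i k X_lo_hi[OF h] by (simp add: nth_list_update)
  also have "i = ?k \<longleftrightarrow> h c = d" using i k e_eq_iff by metis
  finally show "h (coord c d) = (if h c = d then hi else lo)" .
qed

lemma coord_B: "c \<in> univ A \<Longrightarrow> coord c d \<in> carrier B"
  using coord_value[of c d] lo_hi_B(1) by (cases "d \<in> univ E") (fastforce simp: carrier_B, simp add: coord_def)

lemma X_coord: "c \<in> univ A \<Longrightarrow> d \<in> univ E \<Longrightarrow> h \<in> X \<Longrightarrow> h (coord c d) = hi \<longleftrightarrow> h c = d"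
  using coord_value(2)[of c d h] lo_hi by auto

text \<open>Iterating \<open>p\<close> makes the first condition that holds select the value.\<close>

lemma exists_selection:
  assumes "set bds \<subseteq> carrier B \<times> univ E"
  shows "\<exists>x\<in>univ A. \<forall>h\<in>X. (\<exists>(b, d)\<in>set bds. h b = hi) \<longrightarrow> (\<exists>(b, d)\<in>set bds. h b = hi \<and> h x = d)"
  using assms
proof (induction bds)
  case Nil
  then show ?case using lo_hi by auto
next
  case (Cons bd bds)
  obtain b d where bd: "bd = (b, d)" "b \<in> carrier B" "d \<in> univ E" using Cons.prems by auto
  obtain x where x: "x \<in> univ A"
    "\<And>h. h \<in> X \<Longrightarrow> \<exists>(b, d)\<in>set bds. h b = hi \<Longrightarrow> \<exists>(b, d)\<in>set bds. h b = hi \<and> h x = d"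
    using Cons by auto
  have dA: "d \<in> univ A" using bd E_sub by blast
  note p = X_p[OF _ B_A[OF bd(2)] x(1) dA]
  show ?case
  proof (intro bexI[of _ "p b x d"] ballI impI)
    show "p b x d \<in> univ A" using p_closed bd B_A x dA by blast
    fix h assume h: "h \<in> X" and ex: "\<exists>(b, d)\<in>set (bd # bds). h b = hi"
    show "\<exists>(b', d')\<in>set (bd # bds). h b' = hi \<and> h (p b x d) = d'"
    proof (cases "h b = hi")
      case True
      then show ?thesis using p(2)[OF h] X_id[OF h bd(3)] bd(1) by auto
    next
      case False
      then have "h (p b x d) = h x" using p(1)[OF h] X_B[OF h bd(2)] by simp
      then show ?thesis using x(2)[OF h] ex bd(1) False by auto
    qed
  qed
qed

section \<open>The semiring power\<close>

abbreviation V :: "('a \<Rightarrow> 'a) set" where "V \<equiv> vectors R (univ E)"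
abbreviation vsig :: "('f, 'a, 'a) vsym signature" where "vsig \<equiv> vec_sig \<Sigma> R E"
abbreviation valg :: "(('f, 'a, 'a) vsym, 'a \<Rightarrow> 'a) alg" where "valg \<equiv> vec_alg R E"

section \<open>Vectors and lifted operations under a retraction\<close>

lemma V_iff: "v \<in> V \<longleftrightarrow> (\<forall>d. v d \<in> carrier B) \<and> (\<forall>d. d \<notin> univ E \<longrightarrow> v d = lo)"
  using finE lo_hi_B by (auto simp: vectors_def R_simps)

lemma V_B: "v \<in> V \<Longrightarrow> v d \<in> carrier B"
  by (simp add: V_iff)

lemma V_nth_B: "set vs \<subseteq> V \<Longrightarrow> i < length vs \<Longrightarrow> (vs ! i) d \<in> carrier B"
  using V_B nth_mem by blast

lemma X_V_outside: "v \<in> V \<Longrightarrow> h \<in> X \<Longrightarrow> d \<notin> univ E \<Longrightarrow> h (v d) \<noteq> hi"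
  by (simp add: V_iff X_lo_hi lo_hi)

lemma VI:
  assumes "\<And>d. v d \<in> carrier B" "\<And>h d. h \<in> X \<Longrightarrow> d \<notin> univ E \<Longrightarrow> h (v d) \<noteq> hi"
  shows "v \<in> V"
proof -
  have "v d = lo" if "d \<notin> univ E" for d
    using assms that by (intro B_eqI) (auto simp: X_lo_hi lo_hi lo_hi_B)
  then show ?thesis using assms by (simp add: V_iff)
qed

lemma V_eqI:
  assumes "v \<in> V" "w \<in> V" "\<And>h d. h \<in> X \<Longrightarrow> d \<in> univ E \<Longrightarrow> h (v d) = hi \<longleftrightarrow> h (w d) = hi"
  shows "v = w"
proof
  fix d
  show "v d = w d"
    using assms V_B X_V_outside by (intro B_eqI) metis+
qed

lemma basis_vec_V: "d \<in> univ E \<Longrightarrow> basis_vec R d \<in> V"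
  by (auto simp: V_iff basis_vec_def R_simps lo_hi_B)

lemma X_basis_vec: "h \<in> X \<Longrightarrow> h (basis_vec R d d') = hi \<longleftrightarrow> d' = d"
  by (simp add: basis_vec_def R_simps X_lo_hi lo_hi)

text \<open>A retraction \<open>h\<close> turns a vector \<open>v\<close> into the subset of those
  \<open>c\<close> in \<open>E\<close> with \<open>h (v c) = hi\<close>. Sums become disjunctions
  and products conjunctions, so the lifted operation becomes the elementwise operation on
  subsets.\<close>

lemma lift_op_B_and_X:
  assumes "set vs \<subseteq> V"
  shows "lift_op R E g vs d \<in> carrier B"
    "h \<in> X \<Longrightarrow> h (lift_op R E g vs d) = hi \<longleftrightarrow>
      (\<exists>ds. list_all2 (\<lambda>v c. c \<in> univ E \<and> h (v c) = hi) vs ds \<and> interp A g ds = d)"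
proof -
  let ?S = "{ds. list_all2 (\<lambda>v c. c \<in> univ E \<and> v c \<noteq> \<zero>\<^bsub>R\<^esub>) vs ds}"
  let ?m = "\<lambda>ds. foldr (\<lambda>x y. x \<otimes>\<^bsub>R\<^esub> y) (map2 (\<lambda>v c. v c) vs ds) \<one>\<^bsub>R\<^esub>"
  let ?t = "\<lambda>ds. ?m ds \<otimes>\<^bsub>R\<^esub> basis_vec R (interp E g ds) d"
  have "?S \<subseteq> {ds. set ds \<subseteq> univ E \<and> length ds = length vs}"
    by (auto simp: list_all2_conv_all_nth in_set_conv_nth)
  then have fin: "finite ?S" using finite_lists_length_eq[OF finE] by (rule finite_subset)
  have m: "set (map2 (\<lambda>v c. v c) vs ds) \<subseteq> carrier B" for ds
    using assms V_B by (auto simp: set_zip) (meson nth_mem subsetD)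
  have basis: "basis_vec R c d \<in> carrier B" for c
    by (simp add: basis_vec_def R_simps lo_hi_B)
  have t: "?t ds \<in> carrier B" for ds
    using X_foldr[OF m] basis by (simp add: R_simps B_closed)
  show "lift_op R E g vs d \<in> carrier B"
    unfolding lift_op_def using fin t by (intro finsum_closed) auto
  assume h: "h \<in> X"
  have "h (?t ds) = hi \<longleftrightarrow> list_all2 (\<lambda>v c. h (v c) = hi) vs ds \<and> interp A g ds = d" if "ds \<in> ?S" for ds
  proof -
    have len: "length vs = length ds" using that by (auto dest: list_all2_lengthD)
    have "h (?t ds) = hi \<longleftrightarrow> (\<forall>x\<in>set (map2 (\<lambda>v c. v c) vs ds). h x = hi) \<and> d = interp A g ds"
      using X_foldr[OF m] h basis by (simp add: R_simps X_B_ops X_basis_vec[unfolded R_simps] interp_E del: set_map)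
    also have "(\<forall>x\<in>set (map2 (\<lambda>v c. v c) vs ds). h x = hi) \<longleftrightarrow> list_all2 (\<lambda>v c. h (v c) = hi) vs ds"
      using len by (auto simp: list_all2_iff)
    finally show ?thesis by auto
  qed
  \<comment> \<open>A coefficient sent to \<open>hi\<close> is not the zero \<open>lo\<close>, so
    restricting the sum to supports loses no relevant tuple.\<close>
  moreover have "list_all2 (\<lambda>v c. c \<in> univ E \<and> h (v c) = hi) vs ds \<longleftrightarrow>
      ds \<in> ?S \<and> list_all2 (\<lambda>v c. h (v c) = hi) vs ds" for ds
    using X_lo_hi[OF h] lo_hi by (auto simp: list_all2_conv_all_nth R_simps)
  ultimately show "h (lift_op R E g vs d) = hi \<longleftrightarrow>
      (\<exists>ds. list_all2 (\<lambda>v c. c \<in> univ E \<and> h (v c) = hi) vs ds \<and> interp A g ds = d)"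
    unfolding lift_op_def using X_finsum[OF h fin t] by auto
qed

text \<open>In terms of subsets of \<open>E\<close> this is the union of the arguments whose index
  belongs to the first vector. The selector sits at position 0, which shifts the argument for
  \<open>cs ! i\<close> to position \<open>i + 1\<close>.\<close>

lemma Q_B_and_X:
  assumes "set vs \<subseteq> V" "length vs = length cs + 1"
  shows "vec_interp R E (Q cs) vs d \<in> carrier B"
    "h \<in> X \<Longrightarrow> h (vec_interp R E (Q cs) vs d) = hi \<longleftrightarrow>
      (\<exists>i<length cs. h ((vs ! 0) (cs ! i)) = hi \<and> h ((vs ! (i + 1)) d) = hi)"
proof -
  have B: "(vs ! 0) (cs ! i) \<in> carrier B" "(vs ! Suc i) d \<in> carrier B" if "i < length cs" for i
    using that assms V_nth_B by auto
  show "vec_interp R E (Q cs) vs d \<in> carrier B"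
    unfolding vec_interp.simps using B by (intro finsum_closed) (auto simp: R_simps B_closed)
  assume h: "h \<in> X"
  have "h (vec_interp R E (Q cs) vs d) = hi \<longleftrightarrow>
    (\<exists>i\<in>{..<length cs}. h ((vs ! 0) (cs ! i) \<otimes>\<^bsub>R\<^esub> (vs ! (i + 1)) d) = hi)"
    unfolding vec_interp.simps
    by (rule conjunct2[OF X_finsum[OF h]]) (use B in \<open>auto simp: R_simps B_closed\<close>)
  also have "\<dots> \<longleftrightarrow> (\<exists>i<length cs. h ((vs ! 0) (cs ! i)) = hi \<and> h ((vs ! (i + 1)) d) = hi)"
    using B h by (auto simp: R_simps X_B_ops)
  finally show "h (vec_interp R E (Q cs) vs d) = hi \<longleftrightarrow>
      (\<exists>i<length cs. h ((vs ! 0) (cs ! i)) = hi \<and> h ((vs ! (i + 1)) d) = hi)" .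
qed

lemma lift_op_V:
  assumes "g \<in> syms \<Sigma>" "length vs = ar \<Sigma> g" "set vs \<subseteq> V"
  shows "lift_op R E g vs \<in> V"
proof (rule VI)
  fix h d assume h: "h \<in> X" "d \<notin> univ E"
  have "interp A g ds \<in> univ E" if "list_all2 (\<lambda>v c. c \<in> univ E \<and> h (v c) = hi) vs ds" for ds
    using that assms by (intro E_closed) (auto simp: list_all2_conv_all_nth in_set_conv_nth)
  then show "h (lift_op R E g vs d) \<noteq> hi"
    unfolding lift_op_B_and_X(2)[OF assms(3) h(1)] using h(2) by auto
qed (rule lift_op_B_and_X[OF assms(3)])

lemma vec_cases:
  assumes "s \<in> syms vsig"
  obtains g where "s = Base g" "g \<in> syms \<Sigma>" | "s = Plus" | "s = Zero"
    | r where "s = Scale r" "r \<in> carrier B" | cs where "s = Q cs" "cs \<in> enumerations (univ E)"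
    | d where "s = Const d" "d \<in> univ E"
  using assms by (auto simp: vec_sig_def R_simps)

lemma vec_interp_V:
  assumes s: "s \<in> syms vsig" and len: "length vs = ar vsig s" and vs: "set vs \<subseteq> V"
  shows "vec_interp R E s vs \<in> V"
  using s
proof (cases rule: vec_cases)
  case (1 g)
  then show ?thesis using len vs lift_op_V by (simp add: vec_sig_def)
next
  case 2
  then have "vs ! 0 \<in> V" "vs ! 1 \<in> V" using len vs by (auto simp: vec_sig_def subset_iff)
  then show ?thesis
    using 2 V_B by (intro VI) (auto simp: R_simps B_closed X_B_ops X_V_outside)
next
  case 3
  then show ?thesis by (simp add: V_iff R_simps lo_hi_B)
next
  case (4 r)
  then have "vs ! 0 \<in> V" using len vs by (auto simp: vec_sig_def subset_iff)
  then show ?thesis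
    using 4 V_B by (intro VI) (auto simp: R_simps B_closed X_B_ops X_V_outside)
next
  case (5 cs)
  then have l: "length vs = length cs + 1" using len by (simp add: vec_sig_def)
  have "vs ! (i + 1) \<in> V" if "i < length cs" for i using vs l that by (auto simp: subset_iff)
  then show ?thesis
    unfolding 5 using Q_B_and_X[OF vs l] X_V_outside by (intro VI) blast+
next
  case (6 d)
  then show ?thesis using basis_vec_V by simp
qed

lemma is_alg_vec: "is_alg vsig valg"
proof -
  have "basis_vec R lo \<in> V" using basis_vec_V lo_hi by blast
  then show ?thesis
    using vec_interp_V by (auto simp: is_alg_def subuniverse_def vec_alg_def)
qed

text \<open>Each operation on vectors can be computed separately at every retraction. Agreement at a
  given retraction is therefore preserved by all of them, which is the source of the congruences on
  \<open>valg\<close>.\<close>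

lemma vec_op_local:
  assumes s: "s \<in> syms vsig" and len: "length us = ar vsig s" and h: "h \<in> X"
    and us: "set us \<subseteq> V" and ws: "set ws \<subseteq> V"
    and eq: "list_all2 (\<lambda>u w. \<forall>d. h (u d) = hi \<longleftrightarrow> h (w d) = hi) us ws"
  shows "h (vec_interp R E s us d) = hi \<longleftrightarrow> h (vec_interp R E s ws d) = hi"
proof -
  have l: "length ws = length us" using eq by (simp add: list_all2_lengthD)
  have nth: "h ((us ! i) d) = hi \<longleftrightarrow> h ((ws ! i) d) = hi" if "i < length us" for i d
    using eq that by (auto simp: list_all2_conv_all_nth)
  show ?thesis
    using s
  proof (cases rule: vec_cases)
    case (1 g)
    have "list_all2 (\<lambda>v c. c \<in> univ E \<and> h (v c) = hi) us ds \<longleftrightarrow>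
        list_all2 (\<lambda>v c. c \<in> univ E \<and> h (v c) = hi) ws ds" for ds
      using nth l by (auto simp: list_all2_conv_all_nth)
    then show ?thesis
      using 1 lift_op_B_and_X(2)[OF us h] lift_op_B_and_X(2)[OF ws h] by simp
  next
    case 2
    then have "length us = 2" using len by (simp add: vec_sig_def)
    then show ?thesis
      using 2 nth[of 0] nth[of 1] h V_nth_B[OF us] V_nth_B[OF ws] l by (simp add: R_simps X_B_ops)
  next
    case (4 r)
    then have "length us = 1" using len by (simp add: vec_sig_def)
    then show ?thesis
      using 4 nth[of 0] h V_nth_B[OF us] V_nth_B[OF ws] l by (simp add: R_simps X_B_ops)
  next
    case (5 cs)
    then have k: "length us = length cs + 1" using len by (simp add: vec_sig_def)
    then show ?thesis
      unfolding 5 using Q_B_and_X(2)[OF us k h] Q_B_and_X(2)[OF ws _ h] nth l by auto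
  qed auto
qed

section \<open>Finitely central vectors\<close>

definition q_vec :: "'a list \<Rightarrow> ('f, 'a, 'a) vsym trm" where
  "q_vec cs = App (Q cs) (map Var [0..<length cs + 1])"

definition c_vec :: "'a list \<Rightarrow> ('f, 'a, 'a) vsym trm list" where
  "c_vec cs = map (\<lambda>c. App (Const c) []) cs"

lemma trm_op_q_vec:
  assumes "length ws = length cs"
  shows "trm_op valg (q_vec cs) (v # ws) = vec_interp R E (Q cs) (v # ws)"
proof -
  have "map (\<lambda>i. (v # ws) ! i) [0..<length cs + 1] = v # ws"
    using assms map_nth[of "v # ws"] by simp
  then show ?thesis by (simp add: q_vec_def vec_alg_def o_def del: vec_interp.simps upt_Suc)
qed

lemma X_q_vec:
  assumes "length ws = length cs" "v \<in> V" "set ws \<subseteq> V" "h \<in> X"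
  shows "h (trm_op valg (q_vec cs) (v # ws) d) = hi \<longleftrightarrow>
    (\<exists>i<length cs. h (v (cs ! i)) = hi \<and> h ((ws ! i) d) = hi)"
  using Q_B_and_X(2)[of "v # ws" cs h d] assms
  by (simp add: trm_op_q_vec del: vec_interp.simps)

lemma trm_op_c_vec: "i < length cs \<Longrightarrow> trm_op valg (c_vec cs ! i) [] = basis_vec R (cs ! i)"
  by (simp add: c_vec_def vec_alg_def)

lemma dim_alg_vec:
  assumes cs: "cs \<in> enumerations (univ E)"
  shows "dim_alg vsig valg (length cs) (q_vec cs) (c_vec cs)"
  unfolding dim_alg_def
proof (intro conjI ballI allI impI)
  show "is_alg vsig valg" by (rule is_alg_vec)
  show "trm_in vsig (length cs + 1) (q_vec cs)"
    using cs by (auto simp: q_vec_def vec_sig_def)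
  show "length (c_vec cs) = length cs" by (simp add: c_vec_def)
  show "trm_in vsig 0 t" if "t \<in> set (c_vec cs)" for t
    using that cs by (auto simp: c_vec_def vec_sig_def enumerations_def)
next
  fix i bs assume i: "i < length cs" and bs: "length bs = length cs \<and> set bs \<subseteq> univ valg"
  have d: "distinct cs" "set cs \<subseteq> univ E" using cs by (auto simp: enumerations_def)
  have csE: "cs ! i \<in> univ E" using d i by auto
  have bsV: "set bs \<subseteq> V" using bs by (simp add: vec_alg_def)
  have bV: "basis_vec R (cs ! i) \<in> V" by (rule basis_vec_V[OF csE])
  have "trm_op valg (q_vec cs) (basis_vec R (cs ! i) # bs) \<in> V"
    unfolding trm_op_q_vec[OF conjunct1[OF bs]] using cs bV bsV bs
    by (intro vec_interp_V) (auto simp: vec_sig_def)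
  moreover have "bs ! i \<in> V" using bsV bs i by auto
  ultimately have "trm_op valg (q_vec cs) (basis_vec R (cs ! i) # bs) = bs ! i"
  proof (rule V_eqI)
    fix h d assume h: "h \<in> X"
    \<comment> \<open>Since the enumeration is without repetitions, the basis vector selects exactly
      one slot.\<close>
    have "h (basis_vec R (cs ! i) (cs ! j)) = hi \<longleftrightarrow> j = i" if "j < length cs" for j
      unfolding X_basis_vec[OF h] using d(1) i that by (simp add: nth_eq_iff_index_eq)
    then show "h (trm_op valg (q_vec cs) (basis_vec R (cs ! i) # bs) d) = hi \<longleftrightarrow> h ((bs ! i) d) = hi"
      using X_q_vec[OF conjunct1[OF bs] bV bsV h] i by auto
  qed
  then show "trm_op valg (q_vec cs) (trm_op valg (c_vec cs ! i) [] # bs) = bs ! i"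
    using trm_op_c_vec[OF i] by simp
qed

lemma coord_V: "c \<in> univ A \<Longrightarrow> coord c \<in> V"
  using coord_B by (auto simp: V_iff coord_def)

text \<open>Over the retractions that map \<open>c\<close> to \<open>d\<close>, the vector \<open>coord c\<close> agrees with the basis
  vector \<open>d\<close>; agreement over a set of retractions is a congruence.\<close>

lemma coord_finitely_central:
  assumes c: "c \<in> univ A"
  shows "finitely_central \<Sigma> R E (coord c)"
proof -
  \<comment> \<open>The finite set of indices is all of \<open>E\<close>, so each value
    \<open>h c\<close> is some \<open>cs ! i\<close> and the congruences \<open>\<phi> i\<close>
    jointly cover every retraction.\<close>
  obtain cs where cs: "set cs = univ E" "distinct cs" using finite_distinct_list[OF finE] by blast
  have en: "cs \<in> enumerations (univ E)"
    using cs lo_hi(1) by (auto simp: enumerations_def)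
  define \<phi> where "\<phi> i = {(u, w). u \<in> V \<and> w \<in> V \<and>
    (\<forall>h\<in>X. h c = cs ! i \<longrightarrow> (\<forall>d. h (u d) = hi \<longleftrightarrow> h (w d) = hi))}" for i
  have "central vsig valg (length cs) (q_vec cs) (c_vec cs) (coord c)"
  proof (rule centralI[OF dim_alg_vec[OF en], where \<phi> = \<phi>])
    show "coord c \<in> univ valg" using coord_V[OF c] by (simp add: vec_alg_def)
    fix i assume i: "i < length cs"
    have csE: "cs ! i \<in> univ E" using nth_mem[OF i] cs(1) by simp
    show "(coord c, trm_op valg (c_vec cs ! i) []) \<in> \<phi> i"
      unfolding trm_op_c_vec[OF i] \<phi>_def
    proof (intro CollectI case_prodI conjI ballI impI allI)
      fix h d assume h: "h \<in> X" "h c = cs ! i"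
      show "h (coord c d) = hi \<longleftrightarrow> h (basis_vec R (cs ! i) d) = hi"
        using X_coord[OF c _ h(1), of d] X_basis_vec[OF h(1)] h csE X_V_outside[OF coord_V[OF c] h(1), of d]
        by metis
    qed (use coord_V[OF c] basis_vec_V[OF csE] in auto)
    show "is_congruence vsig valg (\<phi> i)"
    proof (rule is_congruenceI)
      fix s us ws
      assume s: "s \<in> syms vsig" "length us = ar vsig s" "list_all2 (\<lambda>x y. (x, y) \<in> \<phi> i) us ws"
        and us: "set us \<subseteq> univ valg" and ws: "set ws \<subseteq> univ valg"
      have V: "set us \<subseteq> V" "set ws \<subseteq> V" using us ws by (simp_all add: vec_alg_def)
      have "length ws = ar vsig s" using s list_all2_lengthD by force
      then have "vec_interp R E s us \<in> V" "vec_interp R E s ws \<in> V"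
        using vec_interp_V s V by auto
      moreover have "h (vec_interp R E s us d) = hi \<longleftrightarrow> h (vec_interp R E s ws d) = hi"
        if "h \<in> X" "h c = cs ! i" for h d
        using s(3) that
        by (intro vec_op_local[OF s(1,2) that(1) V]) (auto simp: \<phi>_def elim!: list_all2_mono)
      ultimately show "(interp valg s us, interp valg s ws) \<in> \<phi> i"
        by (simp add: vec_alg_def \<phi>_def)
    next
      show "(w, u) \<in> \<phi> i" if "(u, w) \<in> \<phi> i" for u w
        using that unfolding \<phi>_def by blast
      show "(u, x) \<in> \<phi> i" if "(u, w) \<in> \<phi> i" "(w, x) \<in> \<phi> i" for u w x
        using that unfolding \<phi>_def by blast
    qed (auto simp: \<phi>_def vec_alg_def)
  next
    fix u w assume "u \<in> univ valg" "w \<in> univ valg" and eq: "\<forall>i<length cs. (u, w) \<in> \<phi> i"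
    then have "u \<in> V" "w \<in> V" by (simp_all add: vec_alg_def)
    then show "u = w"
    proof (rule V_eqI)
      fix h d assume h: "h \<in> X"
      obtain i where "i < length cs" "h c = cs ! i"
        using X_E[OF h c] cs by (metis in_set_conv_nth)
      then show "h (u d) = hi \<longleftrightarrow> h (w d) = hi" using eq h by (auto simp: \<phi>_def)
    qed
  qed
  then show ?thesis unfolding finitely_central_def q_vec_def c_vec_def using en by blast
qed

text \<open>At each retraction exactly one entry of \<open>v\<close> is \<open>hi\<close>: at least
  one because \<open>q\<close> is idempotent, at most one because distinct entries are orthogonal.
  Selecting the index of that entry yields the element of \<open>A\<close>.\<close>

lemma finitely_central_imp_coord:
  assumes "finitely_central \<Sigma> R E v"
  shows "\<exists>c\<in>univ A. v = coord c"
proof -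
  obtain cs where cs: "cs \<in> enumerations (univ E)"
    and cen: "central vsig valg (length cs) (q_vec cs) (c_vec cs) v"
    using assms by (auto simp: finitely_central_def q_vec_def c_vec_def)
  have dcs: "distinct cs" "set cs \<subseteq> univ E" using cs by (auto simp: enumerations_def)
  have v: "v \<in> V" using cen by (simp add: central_def vec_alg_def)
  let ?m = "length cs"
  let ?q = "\<lambda>ws. trm_op valg (q_vec cs) (v # ws)"
  define \<theta> where "\<theta> i = principal_cong vsig valg v (trm_op valg (c_vec cs ! i) [])" for i
  have csE: "cs ! i \<in> univ E" if "i < ?m" for i using that dcs by auto
  have \<theta>: "is_congruence vsig valg (\<theta> i)" if "i < ?m" for i
    unfolding \<theta>_def trm_op_c_vec[OF that] using is_alg_vec v basis_vec_V[OF csE[OF that]]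
    by (intro principal_cong_congruence) (auto simp: vec_alg_def)
  have q_V: "?q ws \<in> V" if "length ws = ?m" "set ws \<subseteq> V" for ws
    using dim_alg_q_closed[OF dim_alg_vec[OF cs], of v ws] v that by (simp add: vec_alg_def)
  have q_iff: "y = ?q ws \<longleftrightarrow> (\<forall>i<?m. (y, ws ! i) \<in> \<theta> i)"
    if "length ws = ?m" "set ws \<subseteq> V" "y \<in> V" for y ws
    using central_eq_iff[OF cen, of ws y] that by (simp add: vec_alg_def \<theta>_def)
  have \<theta>_refl: "(w, w) \<in> \<theta> i" if "w \<in> V" "i < ?m" for w i
    using congruence_refl[OF \<theta>[OF that(2)]] that by (simp add: vec_alg_def)
  have zero: "(\<lambda>d. lo) \<in> V" by (simp add: V_iff lo_hi_B)

  \<comment> \<open>The vector \<open>v\<close> is congruent to the i-th basis vector modulo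
    \<open>\<theta> i\<close>, hence equals \<open>q\<close> applied to \<open>v\<close> and these
    basis vectors; this confines its support to \<open>cs\<close>.\<close>
  have supp: "d \<in> set cs" if h: "h \<in> X" and d: "h (v d) = hi" for h d
  proof -
    let ?ws = "map (basis_vec R) cs"
    have ws: "set ?ws \<subseteq> V" using dcs basis_vec_V by auto
    have "v = ?q ?ws"
      using q_iff[OF _ ws v] by (simp add: \<theta>_def trm_op_c_vec principal_cong_pair)
    then have "h (?q ?ws d) = hi" using d by simp
    then obtain i where "i < ?m" "h ((?ws ! i) d) = hi"
      using X_q_vec[OF _ v ws h, of cs d] by auto
    then show ?thesis using X_basis_vec[OF h, of "cs ! i" d] by simp
  qed
  \<comment> \<open>A constant tuple solves its own congruences, so \<open>q\<close> returns its
    common entry. For a nonzero entry this needs a coefficient of \<open>v\<close> to be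
    \<open>hi\<close>.\<close>
  have ex: "\<exists>d\<in>univ E. h (v d) = hi" if h: "h \<in> X" for h
  proof -
    let ?w = "basis_vec R lo"
    have w: "?w \<in> V" using basis_vec_V lo_hi by blast
    have ws: "set (replicate ?m ?w) \<subseteq> V" using w by auto
    have "?w = ?q (replicate ?m ?w)" using q_iff[OF _ ws w] \<theta>_refl[OF w] by simp
    then have "h (?q (replicate ?m ?w) lo) = hi" using X_basis_vec[OF h, of lo lo] by simp
    then obtain i where "i < ?m" "h (v (cs ! i)) = hi"
      using X_q_vec[OF _ v ws h, of cs lo] by auto
    then show ?thesis using csE by blast
  qed
  have uniq: "d = d'" if h: "h \<in> X" and d: "h (v d) = hi" "h (v d') = hi" for h d d'
  proof (rule ccontr)
    assume "d \<noteq> d'"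
    obtain i j where ij: "i < ?m" "cs ! i = d" "j < ?m" "cs ! j = d'"
      using supp[OF h] d by (metis in_set_conv_nth)
    then have "i \<noteq> j" using \<open>d \<noteq> d'\<close> by auto
    \<comment> \<open>A nonzero vector is put in slot \<open>j\<close>, and the result
      \<open>?u\<close> in slot \<open>i\<close>. Modulo \<open>\<theta> i\<close> the vector
      \<open>?u\<close> is zero, so the second application of \<open>q\<close> gives zero; yet its
      entry at \<open>lo\<close> is the product of the two coefficients of \<open>v\<close>, which
      is \<open>hi\<close> at \<open>h\<close>.\<close>
    let ?z = "\<lambda>d::'a. lo"
    let ?ws = "(replicate ?m ?z)[j := basis_vec R lo]"
    let ?u = "?q ?ws"
    let ?us = "(replicate ?m ?z)[i := ?u]"
    have ws: "length ?ws = ?m" "set ?ws \<subseteq> V"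
      using set_update_subset_insert[of "replicate ?m ?z" j "basis_vec R lo"] zero
        basis_vec_V[OF lo_hi(1)] by auto
    have u: "?u \<in> V" using q_V[OF ws] .
    have us: "length ?us = ?m" "set ?us \<subseteq> V"
      using set_update_subset_insert[of "replicate ?m ?z" i ?u] zero u by auto
    have "(?u, ?ws ! i) \<in> \<theta> i" using q_iff[OF ws u] ij by blast
    then have "(?z, ?u) \<in> \<theta> i"
      using congruence_sym[OF \<theta>] ij \<open>i \<noteq> j\<close> by simp
    then have "(?z, ?us ! k) \<in> \<theta> k" if "k < ?m" for k
      using \<theta>_refl[OF zero that] that by (cases "k = i") auto
    then have "?z = ?q ?us" using q_iff[OF us zero] by blast
    then have "h (?q ?us lo) \<noteq> hi" using X_lo_hi[OF h] lo_hi by (metis (no_types))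
    moreover have "h (?q ?us lo) = hi"
    proof -
      have "h ((?ws ! j) lo) = hi" using ij X_basis_vec[OF h, of lo lo] by simp
      then have "h (?u lo) = hi" using X_q_vec[OF ws(1) v ws(2) h, of lo] ij d by blast
      then have "h ((?us ! i) lo) = hi" using ij by simp
      then show ?thesis using X_q_vec[OF us(1) v us(2) h, of lo] ij d by blast
    qed
    ultimately show False by simp
  qed

  \<comment> \<open>The coefficient \<open>v d\<close> serves as the condition for the value
    \<open>d\<close>; exactly one condition holds at each retraction, so the order of the list is
    irrelevant.\<close>
  obtain ds where ds: "set ds = univ E" using finite_list[OF finE] by blast
  let ?L = "map (\<lambda>d. (v d, d)) ds"
  have "set ?L \<subseteq> carrier B \<times> univ E" using V_B[OF v] ds by auto
  then obtain x where x: "x \<in> univ A"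
    "\<forall>h\<in>X. (\<exists>(b, d)\<in>set ?L. h b = hi) \<longrightarrow> (\<exists>(b, d)\<in>set ?L. h b = hi \<and> h x = d)"
    using exists_selection by blast
  have "v = coord x"
  proof (rule V_eqI[OF v coord_V[OF x(1)]])
    fix h d assume h: "h \<in> X" and d: "d \<in> univ E"
    have "h (v (h x)) = hi" using bspec[OF x(2) h] ex[OF h] ds by auto
    then show "h (v d) = hi \<longleftrightarrow> h (coord x d) = hi"
      unfolding X_coord[OF x(1) d h] using uniq[OF h] by metis
  qed
  then show ?thesis using x(1) by blast
qed

text \<open>At a retraction \<open>h\<close> the vector \<open>coord c\<close> is the singleton of
  \<open>h c\<close>. Injectivity is thus separation of points, and on singletons the elementwise
  operation is the one of \<open>E\<close>.\<close>

lemma iso_semiring_power: "is_iso \<Sigma> A (semiring_power \<Sigma> E R) coord"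
  unfolding is_iso_def
proof (intro conjI ballI allI impI)
  have "inj_on coord (univ A)"
  proof (rule inj_onI)
    fix x y assume xy: "x \<in> univ A" "y \<in> univ A" "coord x = coord y"
    show "x = y"
    proof (rule X_separates[OF xy(1,2)])
      fix h assume h: "h \<in> X"
      have "h (coord y (h x)) = hi"
        using X_coord[OF xy(1) X_E[OF h xy(1)] h] xy(3) by simp
      then show "h x = h y" using X_coord[OF xy(2) X_E[OF h xy(1)] h] by simp
    qed
  qed
  moreover have "coord ` univ A = univ (semiring_power \<Sigma> E R)"
    using coord_finitely_central finitely_central_imp_coord by (auto simp: semiring_power_def)
  ultimately show "bij_betw coord (univ A) (univ (semiring_power \<Sigma> E R))"
    by (simp add: bij_betw_def)
next
  fix f xs assume f: "f \<in> syms \<Sigma>" and "length xs = ar \<Sigma> f \<and> set xs \<subseteq> univ A"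
  then have xs: "length xs = ar \<Sigma> f" "set xs \<subseteq> univ A" by auto
  have vs: "set (map coord xs) \<subseteq> V" using xs coord_V by auto
  have "coord (interp A f xs) = lift_op R E f (map coord xs)"
  proof (rule V_eqI)
    show "coord (interp A f xs) \<in> V" using f xs interp_closed coord_V by blast
    show "lift_op R E f (map coord xs) \<in> V" using f xs vs by (intro lift_op_V) auto
    fix h d assume h: "h \<in> X" and d: "d \<in> univ E"
    \<comment> \<open>Singletons leave only one tuple of choices.\<close>
    have "list_all2 (\<lambda>v c. c \<in> univ E \<and> h (v c) = hi) (map coord xs) ds \<longleftrightarrow> ds = map h xs" for ds
    proof -
      have "c \<in> univ E \<and> h (coord x c) = hi \<longleftrightarrow> h x = c" if "x \<in> set xs" for x c
        using that xs X_coord[of x c h] X_E[OF h, of x] h by auto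
      then have "list_all2 (\<lambda>v c. c \<in> univ E \<and> h (v c) = hi) (map coord xs) ds \<longleftrightarrow>
          list_all2 (\<lambda>x c. h x = c) xs ds"
        by (auto simp: list_all2_conv_all_nth)
      then show ?thesis by (auto simp: list_all2_conv_all_nth intro: nth_equalityI)
    qed
    then have "h (lift_op R E f (map coord xs) d) = hi \<longleftrightarrow> interp A f (map h xs) = d"
      unfolding lift_op_B_and_X(2)[OF vs h] by simp
    also have "\<dots> \<longleftrightarrow> h (coord (interp A f xs) d) = hi"
      using X_coord[OF interp_closed[OF f xs] d h] X_hom[OF h f xs] by simp
    finally show "h (coord (interp A f xs) d) = hi \<longleftrightarrow> h (lift_op R E f (map coord xs) d) = hi"
      by simp
  qed
  then show "coord (interp A f xs) = interp (semiring_power \<Sigma> E R) f (map coord xs)"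
    by (simp add: semiring_power_def)
qed

section \<open>The Stone space\<close>

definition uf :: "('a \<Rightarrow> 'a) \<Rightarrow> 'a set" where
  "uf h = {b \<in> carrier B. h b = hi}"

lemma uf_ultrafilter:
  assumes h: "h \<in> X"
  shows "ultrafilter B (uf h)"
  unfolding ultrafilter_def
proof (intro conjI ballI impI)
  show "b \<in> uf h" if "a \<in> uf h" "b \<in> carrier B" "meet B a b = a" for a b
    using that X_B_ops(1)[OF h, of a b] by (auto simp: uf_def)
qed (auto simp: uf_def X_B_ops[OF h] B_closed B_simps(4,5) lo_hi_B lo_hi X_lo_hi[OF h])

text \<open>Compactness is applied to the complements of the members of \<open>F\<close>. Finitely
  many members have a lower bound \<open>m\<close> in \<open>F\<close>, which is not
  \<open>lo\<close> and so is \<open>hi\<close> at some retraction. The limit retraction is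
  \<open>hi\<close> on \<open>F\<close>, and an element outside \<open>F\<close> has its complement
  in \<open>F\<close>.\<close>

lemma ultrafilter_uf:
  assumes F: "ultrafilter B F"
  shows "\<exists>h\<in>X. F = uf h"
proof -
  have FB: "F \<subseteq> carrier B" and hiF: "hi \<in> F" and loF: "lo \<notin> F"
    and meetF: "\<And>a b. a \<in> F \<Longrightarrow> b \<in> F \<Longrightarrow> meet B a b \<in> F"
    and ultra: "\<And>a. a \<in> carrier B \<Longrightarrow> a \<in> F \<or> compl B a \<in> F"
    using F by (auto simp: ultrafilter_def B_simps(4,5))
  have meets: "\<exists>m\<in>F. \<forall>h\<in>X. h m = hi \<longrightarrow> (\<forall>b\<in>T. h b = hi)" if "finite T" "T \<subseteq> F" for T
    using that
  proof (induction T)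
    case empty
    then show ?case using hiF by auto
  next
    case (insert a T)
    then obtain m where m: "m \<in> F" "\<forall>h\<in>X. h m = hi \<longrightarrow> (\<forall>b\<in>T. h b = hi)" by auto
    have am: "a \<in> F" "a \<in> carrier B" "m \<in> carrier B" using insert.prems m FB by auto
    show ?case
      using m(2) X_B_ops(1)[OF _ am(2,3)] by (intro bexI[OF _ meetF[OF am(1) m(1)]]) simp
  qed
  have "\<exists>h\<in>X. \<forall>b\<in>compl B ` F. h b = e 0"
  proof (rule X_compact)
    show "compl B ` F \<subseteq> univ A" using FB B_closed B_A by blast
    fix T assume "finite T" "T \<subseteq> compl B ` F"
    then obtain T' where T': "finite T'" "T' \<subseteq> F" "T = compl B ` T'" by (meson finite_subset_image)
    then obtain m where m: "m \<in> F" "\<forall>h\<in>X. h m = hi \<longrightarrow> (\<forall>b\<in>T'. h b = hi)" using meets by blast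
    have "m \<noteq> lo" using m(1) loF by auto
    then obtain h where h: "h \<in> X" "h m = hi"
      using B_eqI[of m lo] m(1) FB lo_hi_B X_lo_hi lo_hi by (metis subsetD)
    have "h (compl B b) = lo" if "b \<in> T'" for b
    proof -
      have "b \<in> carrier B" "h b = hi" using that T' FB m h by auto
      then show ?thesis using X_B_ops(3)[OF h(1), of b b] X_B[OF h(1)] B_closed(3)[of b b] by blast
    qed
    then show "\<exists>h\<in>X. \<forall>b\<in>T. h b = e 0" using h(1) T'(3) lo_def by auto
  qed
  then obtain h where h: "h \<in> X" "\<And>b. b \<in> F \<Longrightarrow> h (compl B b) = lo" by (auto simp: lo_def)
  have Fh: "h b = hi" if "b \<in> F" for b
    using h that X_B_ops(3)[OF h(1), of b b] FB lo_hi by auto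
  have "b \<in> F" if "b \<in> carrier B" "h b = hi" for b
    using ultra[OF that(1)] Fh[of "compl B b"] X_B_ops(3)[OF h(1), of b b] that by auto
  then have "F = uf h" using Fh FB by (auto simp: uf_def)
  then show ?thesis using h by blast
qed

section \<open>Continuous maps on the Stone space\<close>

abbreviation S :: "'a set topology" where "S \<equiv> stone_space B"

lemma topspace_S: "topspace S = {F. ultrafilter B F}"
  unfolding stone_space_def topology_generated_by_topspace
  using lo_hi_B by (auto simp: ultrafilter_def B_simps)

text \<open>The generating sets form a basis: an ultrafilter containing \<open>meet B a b\<close>
  contains both \<open>a\<close> and \<open>b\<close>, as is seen at a retraction that represents
  it.\<close>

lemma openin_S_basic:
  assumes "openin S U" "F \<in> U"
  shows "\<exists>b\<in>F. \<forall>G. ultrafilter B G \<and> b \<in> G \<longrightarrow> G \<in> U"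
proof -
  have "generate_topology_on {{F. ultrafilter B F \<and> a \<in> F} | a. a \<in> carrier B} U"
    using assms(1) by (simp add: stone_space_def openin_topology_generated_by_iff)
  moreover have "ultrafilter B F"
    using assms openin_subset topspace_S by blast
  ultimately show ?thesis using assms(2)
  proof (induction arbitrary: F)
    case (Int U W)
    obtain a where a: "a \<in> F" "\<forall>G. ultrafilter B G \<and> a \<in> G \<longrightarrow> G \<in> U"
      using Int.IH(1)[OF Int.prems(1)] Int.prems(2) by blast
    obtain b where b: "b \<in> F" "\<forall>G. ultrafilter B G \<and> b \<in> G \<longrightarrow> G \<in> W"
      using Int.IH(2)[OF Int.prems(1)] Int.prems(2) by blast
    have "a \<in> G \<and> b \<in> G" if G: "ultrafilter B G" "meet B a b \<in> G" for G
    proof -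
      obtain h where h: "h \<in> X" "G = uf h" using ultrafilter_uf[OF G(1)] by blast
      moreover have "a \<in> carrier B" "b \<in> carrier B" using a b Int.prems(1) by (auto simp: ultrafilter_def)
      ultimately show ?thesis using G(2) X_B_ops(1)[OF h(1), of a b] by (simp add: uf_def)
    qed
    moreover have "meet B a b \<in> F" using a b Int.prems(1) by (simp add: ultrafilter_def)
    ultimately show ?case using a(2) b(2) by blast
  next
    case (UN K)
    then obtain U where U: "U \<in> K" "F \<in> U" by blast
    show ?case using UN.IH[OF U(1) UN.prems(1) U(2)] U(1) by blast
  qed auto
qed

text \<open>A choice is made because functions in \<open>X\<close> with the same values on
  \<open>univ A\<close> give the same ultrafilter; \<open>retr_uf\<close> shows that the choice does
  not affect values on \<open>univ A\<close>.\<close>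

definition retr :: "'a set \<Rightarrow> 'a \<Rightarrow> 'a" where
  "retr F = (SOME h. h \<in> X \<and> F = uf h)"

lemma retr: "ultrafilter B F \<Longrightarrow> retr F \<in> X" "ultrafilter B F \<Longrightarrow> uf (retr F) = F"
  using someI_ex[of "\<lambda>h. h \<in> X \<and> F = uf h"] ultrafilter_uf[of F] unfolding retr_def by blast+

lemma uf_coord_iff:
  assumes "h \<in> X" "c \<in> univ A" "d \<in> univ E"
  shows "coord c d \<in> uf h \<longleftrightarrow> h c = d"
  using X_coord[OF assms(2,3,1)] coord_B[OF assms(2)] by (simp add: uf_def)

text \<open>The ultrafilter \<open>uf h\<close> contains \<open>coord c d\<close> exactly for
  \<open>d = h c\<close>, so it determines the values of \<open>h\<close> on
  \<open>univ A\<close>.\<close>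

lemma retr_uf:
  assumes "h \<in> X" "c \<in> univ A"
  shows "retr (uf h) c = h c"
  using uf_coord_iff[OF assms X_E[OF assms]] retr[OF uf_ultrafilter[OF assms(1)]]
    uf_coord_iff[OF _ assms(2) X_E[OF assms], of "retr (uf h)"] by simp

text \<open>The set \<open>T\<close> consists of the Boolean elements on whose clopen sets
  \<open>f\<close> is constant. Continuity makes these sets a cover, compactness leaves finitely
  many, and selection turns them with their values into an element of \<open>A\<close>.\<close>

lemma continuous_selection:
  assumes f: "continuous_map S (discrete_topology (univ E)) f"
  obtains x where "x \<in> univ A" "\<And>F. ultrafilter B F \<Longrightarrow> retr F x = f F"
proof -
  have fE: "f F \<in> univ E" if "ultrafilter B F" for F
    using continuous_map_image_subset_topspace[OF f] that topspace_S by auto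
  define T where "T = {b \<in> carrier B. \<exists>d\<in>univ E. \<forall>G. ultrafilter B G \<and> b \<in> G \<longrightarrow> f G = d}"
  have cover: "\<exists>b\<in>T. b \<in> F" if F: "ultrafilter B F" for F
  proof -
    have "openin S {G \<in> topspace S. f G \<in> {f F}}"
      using f fE[OF F] by (intro openin_continuous_map_preimage) auto
    moreover have "F \<in> {G \<in> topspace S. f G \<in> {f F}}" using F topspace_S by auto
    ultimately have "\<exists>b\<in>F. \<forall>G. ultrafilter B G \<and> b \<in> G \<longrightarrow> G \<in> {G \<in> topspace S. f G \<in> {f F}}"
      by (rule openin_S_basic)
    then obtain b where b: "b \<in> F" "\<forall>G. ultrafilter B G \<and> b \<in> G \<longrightarrow> f G = f F" by blast
    have "b \<in> carrier B" using F b(1) by (auto simp: ultrafilter_def)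
    then have "b \<in> T" unfolding T_def using b(2) fE[OF F] by blast
    then show ?thesis using b by blast
  qed
  \<comment> \<open>A retraction sending all of \<open>T\<close> to \<open>lo\<close> would give an
    ultrafilter that the cover misses.\<close>
  have "\<not> (\<exists>h\<in>X. \<forall>b\<in>T. h b = e 0)"
  proof
    assume "\<exists>h\<in>X. \<forall>b\<in>T. h b = e 0"
    then obtain h where h: "h \<in> X" "\<forall>b\<in>T. h b = lo" by (auto simp: lo_def)
    then show False using cover[OF uf_ultrafilter[OF h(1)]] lo_hi by (auto simp: uf_def)
  qed
  moreover have "T \<subseteq> univ A" using B_A by (auto simp: T_def)
  ultimately obtain T' where T': "finite T'" "T' \<subseteq> T" "\<And>h. h \<in> X \<Longrightarrow> \<exists>b\<in>T'. h b \<noteq> e 0"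
    using X_compact[of T] by metis
  obtain bs where bs: "set bs = T'" using finite_list[OF T'(1)] by blast
  \<comment> \<open>Where clopen sets overlap the chosen values agree, both being the value of
    \<open>f\<close>; for an empty clopen set any value in \<open>E\<close> may be chosen.\<close>
  have "\<forall>b\<in>T'. \<exists>d\<in>univ E. \<forall>G. ultrafilter B G \<and> b \<in> G \<longrightarrow> f G = d"
    using T'(2) by (auto simp: T_def)
  then obtain \<delta> where \<delta>: "\<And>b. b \<in> T' \<Longrightarrow> \<delta> b \<in> univ E"
      "\<And>b G. b \<in> T' \<Longrightarrow> ultrafilter B G \<Longrightarrow> b \<in> G \<Longrightarrow> f G = \<delta> b"
    by metis
  have T'B: "T' \<subseteq> carrier B" using T'(2) by (auto simp: T_def)
  let ?L = "map (\<lambda>b. (b, \<delta> b)) bs"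
  have "set ?L \<subseteq> carrier B \<times> univ E" using bs \<delta>(1) T'B by auto
  then obtain x where x: "x \<in> univ A"
    "\<forall>h\<in>X. (\<exists>(b, d)\<in>set ?L. h b = hi) \<longrightarrow> (\<exists>(b, d)\<in>set ?L. h b = hi \<and> h x = d)"
    using exists_selection by blast
  have "retr F x = f F" if F: "ultrafilter B F" for F
  proof -
    note h = retr[OF F]
    obtain b where "b \<in> T'" "retr F b = hi"
      using T'(3)[OF h(1)] X_B[OF h(1)] T'B by (auto simp: lo_def)
    then have "\<exists>(b, d)\<in>set ?L. retr F b = hi" using bs by auto
    then obtain b where b: "b \<in> T'" "retr F b = hi" "retr F x = \<delta> b"
      using bspec[OF x(2) h(1)] bs by auto
    then have "b \<in> F" using h(2) T'B by (auto simp: uf_def)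
    then show ?thesis using \<delta>(2)[OF b(1) F] b(3) by simp
  qed
  then show ?thesis using that x(1) by blast
qed

text \<open>An element acts on ultrafilters by evaluation at the corresponding retractions.
  Separation of points gives injectivity, and \<open>continuous_selection\<close> gives
  surjectivity.\<close>

lemma iso_continuous: "is_iso \<Sigma> A (continuous_alg S E) (\<lambda>x. \<lambda>F\<in>topspace S. retr F x)"
  unfolding is_iso_def
proof (intro conjI ballI allI impI)
  let ?\<Phi> = "\<lambda>x. \<lambda>F\<in>topspace S. retr F x"
  have uf_S: "uf h \<in> topspace S" if "h \<in> X" for h
    using uf_ultrafilter[OF that] topspace_S by simp
  have "inj_on ?\<Phi> (univ A)"
  proof (rule inj_onI)
    fix x y assume xy: "x \<in> univ A" "y \<in> univ A" "?\<Phi> x = ?\<Phi> y"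
    show "x = y"
    proof (rule X_separates[OF xy(1,2)])
      fix h assume h: "h \<in> X"
      show "h x = h y"
        using fun_cong[OF xy(3), of "uf h"] uf_S[OF h] retr_uf[OF h] xy(1,2) by simp
    qed
  qed
  moreover have "?\<Phi> ` univ A = univ (continuous_alg S E)"
  proof
    show "?\<Phi> ` univ A \<subseteq> univ (continuous_alg S E)"
    proof (rule image_subsetI)
      fix x assume x: "x \<in> univ A"
      have "openin S {F \<in> topspace S. ?\<Phi> x F \<in> U}" if "U \<subseteq> univ E" for U
      proof -
        \<comment> \<open>Continuity: a preimage is the union of the basic open sets of the
          coordinates of \<open>x\<close> at the values in \<open>U\<close>.\<close>
        have "{F \<in> topspace S. ?\<Phi> x F \<in> U} = (\<Union>d\<in>U. {F. ultrafilter B F \<and> coord x d \<in> F})"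
        proof -
          have "coord x d \<in> F \<longleftrightarrow> retr F x = d" if "ultrafilter B F" "d \<in> U" for F d
            using uf_coord_iff[OF retr(1)[OF that(1)] x, of d] retr(2)[OF that(1)] that \<open>U \<subseteq> _\<close> by auto
          then show ?thesis by (auto simp: topspace_S)
        qed
        moreover have "openin S {F. ultrafilter B F \<and> coord x d \<in> F}" for d
          unfolding stone_space_def using coord_B[OF x] by (intro topology_generated_by_Basis) blast
        ultimately show ?thesis by auto
      qed
      moreover have "?\<Phi> x F \<in> univ E" if "F \<in> topspace S" for F
        using that X_E[OF retr(1) x] topspace_S by simp
      ultimately show "?\<Phi> x \<in> univ (continuous_alg S E)"
        by (auto simp: continuous_alg_def continuous_map_def)
    qed
    show "univ (continuous_alg S E) \<subseteq> ?\<Phi> ` univ A"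
    proof
      fix f assume f: "f \<in> univ (continuous_alg S E)"
      then obtain x where x: "x \<in> univ A" "\<And>F. ultrafilter B F \<Longrightarrow> retr F x = f F"
        using continuous_selection[of f] by (auto simp: continuous_alg_def)
      have "f = ?\<Phi> x"
        using f x(2) by (auto simp: continuous_alg_def extensional_def topspace_S)
      then show "f \<in> ?\<Phi> ` univ A" using x(1) by blast
    qed
  qed
  ultimately show "bij_betw ?\<Phi> (univ A) (univ (continuous_alg S E))"
    by (simp add: bij_betw_def)
next
  fix f xs assume f: "f \<in> syms \<Sigma>" and "length xs = ar \<Sigma> f \<and> set xs \<subseteq> univ A"
  then have xs: "length xs = ar \<Sigma> f" "set xs \<subseteq> univ A" by auto
  have "retr F (interp A f xs) = interp A f (map (retr F) xs)" if "F \<in> topspace S" for F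
    using X_hom[OF retr(1) f xs] that by (simp add: topspace_S)
  then show "(\<lambda>F\<in>topspace S. retr F (interp A f xs)) =
      interp (continuous_alg S E) f (map (\<lambda>x. \<lambda>F\<in>topspace S. retr F x) xs)"
    by (auto simp: continuous_alg_def interp_E o_def intro!: restrict_ext)
qed

end

theorem theorem6p11:
  fixes \<Sigma> :: "'f signature" and A E :: "('f, 'a) alg"
    and n :: nat and q :: "'f trm" and es :: "'f trm list"
  assumes "n \<ge> 2"
    and "boolean_like \<Sigma> A n q es"
    and "E = minimal_subalg \<Sigma> A"
    and "finite (univ E)" and "card (univ E) = n"
  shows "isomorphic \<Sigma> A (semiring_power \<Sigma> E (semiring_of (B_alg A q es))) \<and>
    isomorphic \<Sigma> (semiring_power \<Sigma> E (semiring_of (B_alg A q es)))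
      (continuous_alg (stone_space (B_alg A q es)) E)"
proof -
  interpret minimal_boolean_like \<Sigma> A n q es E
    using assms by unfold_locales
  show ?thesis
    using iso_semiring_power isomorphic_span[OF alg iso_semiring_power iso_continuous]
    by (auto simp: isomorphic_def)
qed

end
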